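(* Let $(\mathbb M^{n+m},\mathcal F,g_0)$ be a smooth, connected, complete manifold with a Riemannian foliation $\mathcal F$ having $m$-dimensional totally geodesic leaves and bundle-like metric $g_0$. Let $g(t)=g_{\mathcal H}(t)\oplus g_{\mathcal V}$ be a solution of the transverse flow $$\frac{\partial}{\partial t}g_{\mathcal H}(t)=h(t),\qquad \frac{\partial}{\partial t}g_{\mathcal V}=0,\qquad g(0)=g_0,$$ where $h(t)$ is a symmetric $(0,2)$ tensor with $h(X,Z)=0$ whenever $X\in\Gamma^\infty(\mathcal V)$ or $Z\in\Gamma^\infty(\mathcal V)$ (in particular, a solution of the transverse Ricci flow, i.e. $h(t)=-2\mathbf{Ric}_{\mathcal H}(t)$). Then the flow preserves the totally geodesic foliation condition: at every time $t$ the leaves of $\mathcal F$ are totally geodesic for $g(t)$, i.e. the flow generated by any (time-dependent) basic horizontal vector field $X(t)$ induces an isometry between the leaves, $(\mathcal L_{X(t)}g(t))(Z_1,Z_2)=0$ for all vertical $Z_1,Z_2$.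
   Context: $\mathcal V\subset T\mathbb M$ is the bundle of vectors tangent to the leaves (vertical) and $\mathcal H=\mathcal V^\perp$ (horizontal, rank $n$, assumed bracket generating); $g_{\mathcal H},g_{\mathcal V}$ are the restrictions of $g$ to $\mathcal H,\mathcal V$, and $\Gamma^\infty(\cdot)$ denotes smooth sections. A vector field $X$ is foliate if $[X,Z]$ is vertical for every vertical $Z$; it is basic if it is foliate and horizontal (locally, the horizontal lift of a vector field on the local quotient by the leaves). A metric $g$ is bundle-like if for every open $U$ and all horizontal foliate $X,Y$ on $U$, $Z\,g(X,Y)=0$ for all vertical $Z$. $\mathcal L$ denotes the Lie derivative. $\mathbf{Ric}_{\mathcal H}(t)$ is the horizontal Ricci curvature (horizontal trace of the curvature tensor, evaluated on horizontal parts) of the Bott connection of $g(t)$, defined from the Levi-Civita connection $\nabla^R$ of $g(t)$ and the orthogonal projections $\pi_{\mathcal H},\pi_{\mathcal V}$ by: $\nabla_XY=\pi_{\mathcal H}(\nabla^R_XY)$ for $X,Y$ horizontal; $\pi_{\mathcal H}([X,Y])$ for $X$ vertical, $Y$ horizontal; $\pi_{\mathcal V}([X,Y])$ for $X$ horizontal, $Y$ vertical; $\pi_{\mathcal V}(\nabla^R_XY)$ for $X,Y$ vertical. *)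

theory Defs
  imports "HOL-Analysis.Analysis" "HOL-Library.Function_Algebras"
begin

section \<open>Smooth maps between Euclidean spaces\<close>

text \<open>Only meaningful for open sets \<open>S\<close>.\<close>

fun Ck_on :: "nat \<Rightarrow> 'a::euclidean_space set \<Rightarrow> ('a \<Rightarrow> 'b::real_normed_vector) \<Rightarrow> bool" where
  "Ck_on 0 S f = continuous_on S f"
| "Ck_on (Suc k) S f =
     ((\<forall>x\<in>S. f differentiable (at x)) \<and>
      (\<forall>b\<in>Basis. Ck_on k S (\<lambda>x. frechet_derivative f (at x) b)))"

definition smooth_on :: "'a::euclidean_space set \<Rightarrow> ('a \<Rightarrow> 'b::real_normed_vector) \<Rightarrow> bool" where
  "smooth_on S f \<longleftrightarrow> (\<forall>k. Ck_on k S f)"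

section \<open>Smooth manifolds\<close>

text \<open>
  The manifold is the whole type \<open>'p\<close> (Hausdorff and second countable by its sort), equipped with
  a smooth atlas, i.e. a set of charts \<open>(U, \<phi>)\<close>. Only the values of \<open>\<phi>\<close> on \<open>U\<close> matter.
\<close>

type_synonym ('p, 'e) chart = "'p set \<times> ('p \<Rightarrow> 'e)"

definition is_chart :: "('p::topological_space, 'e::euclidean_space) chart \<Rightarrow> bool" where
  "is_chart c \<longleftrightarrow> (case c of (U, \<phi>) \<Rightarrow>
     open U \<and> open (\<phi> ` U) \<and> homeomorphism U (\<phi> ` U) \<phi> (inv_into U \<phi>))"

definition smooth_atlas ::
    "('p::{t2_space,second_countable_topology}, 'e::euclidean_space) chart set \<Rightarrow> bool" where
  "smooth_atlas A \<longleftrightarrow>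
     (\<forall>c\<in>A. is_chart c) \<and> (\<Union>(U, \<phi>)\<in>A. U) = UNIV \<and>
     (\<forall>(U, \<phi>)\<in>A. \<forall>(V, \<psi>)\<in>A. smooth_on (\<phi> ` (U \<inter> V)) (\<psi> \<circ> inv_into U \<phi>))"

definition smooth_fun ::
    "('p::topological_space, 'e::euclidean_space) chart set \<Rightarrow> 'p set \<Rightarrow> ('p \<Rightarrow> real) \<Rightarrow> bool" where
  "smooth_fun A W f \<longleftrightarrow> (\<forall>(U, \<phi>)\<in>A. smooth_on (\<phi> ` (U \<inter> W)) (f \<circ> inv_into U \<phi>))"

definition smooth_at ::
    "('p::topological_space, 'e::euclidean_space) chart set \<Rightarrow> 'p \<Rightarrow> ('p \<Rightarrow> real) \<Rightarrow> bool" where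
  "smooth_at A p f \<longleftrightarrow> (\<exists>W. open W \<and> p \<in> W \<and> smooth_fun A W f)"

section \<open>Tangent vectors and vector fields\<close>

text \<open>
  A tangent vector at \<open>p\<close> is a derivation of the algebra of germs at \<open>p\<close> of smooth functions. It is
  a functional on all real functions, normalised to vanish on those not smooth near \<open>p\<close>, so that
  equal tangent vectors are equal as functions. Sums and differences of tangent vectors and of
  vector fields are the pointwise ones.
\<close>

type_synonym 'p tvec = "('p \<Rightarrow> real) \<Rightarrow> real"
type_synonym 'p vfield = "'p \<Rightarrow> 'p tvec"
type_synonym 'p tensor02 = "'p \<Rightarrow> 'p tvec \<Rightarrow> 'p tvec \<Rightarrow> real"

definition tscale :: "real \<Rightarrow> 'p tvec \<Rightarrow> 'p tvec"  (infixr "*\<^sub>T" 75) where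
  "c *\<^sub>T v = (\<lambda>f. c * v f)"

definition fscale :: "('p \<Rightarrow> real) \<Rightarrow> 'p vfield \<Rightarrow> 'p vfield" where
  "fscale f X = (\<lambda>p. f p *\<^sub>T X p)"

definition tangent_space ::
    "('p::topological_space, 'e::euclidean_space) chart set \<Rightarrow> 'p \<Rightarrow> 'p tvec set" where
  "tangent_space A p = {v.
     (\<forall>f. \<not> smooth_at A p f \<longrightarrow> v f = 0) \<and>
     (\<forall>f g. smooth_at A p f \<longrightarrow> smooth_at A p g \<longrightarrow> (\<forall>\<^sub>F q in nhds p. f q = g q) \<longrightarrow> v f = v g) \<and>
     (\<forall>f g a b. smooth_at A p f \<longrightarrow> smooth_at A p g \<longrightarrow>
        v (\<lambda>q. a * f q + b * g q) = a * v f + b * v g) \<and>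
     (\<forall>f g. smooth_at A p f \<longrightarrow> smooth_at A p g \<longrightarrow>
        v (\<lambda>q. f q * g q) = f p * v g + g p * v f)}"

text \<open>Smooth vector fields on an open set \<open>U\<close>; the values outside \<open>U\<close> are irrelevant.\<close>

definition vfields ::
    "('p::topological_space, 'e::euclidean_space) chart set \<Rightarrow> 'p set \<Rightarrow> 'p vfield set" where
  "vfields A U = {X.
     (\<forall>p\<in>U. X p \<in> tangent_space A p) \<and>
     (\<forall>W f. open W \<longrightarrow> W \<subseteq> U \<longrightarrow> smooth_fun A W f \<longrightarrow> smooth_fun A W (\<lambda>p. X p f))}"

definition sections ::
    "('p::topological_space, 'e::euclidean_space) chart set \<Rightarrow> ('p \<Rightarrow> 'p tvec set) \<Rightarrow>
     'p set \<Rightarrow> 'p vfield set" where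
  "sections A E U = {X \<in> vfields A U. \<forall>p\<in>U. X p \<in> E p}"

definition lie_bracket ::
    "('p::topological_space, 'e::euclidean_space) chart set \<Rightarrow> 'p vfield \<Rightarrow> 'p vfield \<Rightarrow> 'p vfield" where
  "lie_bracket A X Y = (\<lambda>p f. if smooth_at A p f
     then X p (\<lambda>q. Y q f) - Y p (\<lambda>q. X q f) else 0)"

text \<open>Smooth (0,2) tensor fields; the values on non-tangent arguments are irrelevant.\<close>

definition tensor_field ::
    "('p::topological_space, 'e::euclidean_space) chart set \<Rightarrow> 'p tensor02 \<Rightarrow> bool" where
  "tensor_field A h \<longleftrightarrow>
     (\<forall>p. \<forall>u\<in>tangent_space A p. \<forall>v\<in>tangent_space A p. \<forall>w\<in>tangent_space A p. \<forall>a b.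
        h p (a *\<^sub>T u + b *\<^sub>T v) w = a * h p u w + b * h p v w \<and>
        h p w (a *\<^sub>T u + b *\<^sub>T v) = a * h p w u + b * h p w v) \<and>
     (\<forall>U X Y. open U \<longrightarrow> X \<in> vfields A U \<longrightarrow> Y \<in> vfields A U \<longrightarrow>
        smooth_fun A U (\<lambda>p. h p (X p) (Y p)))"

definition symmetric_tensor_field ::
    "('p::topological_space, 'e::euclidean_space) chart set \<Rightarrow> 'p tensor02 \<Rightarrow> bool" where
  "symmetric_tensor_field A h \<longleftrightarrow> tensor_field A h \<and>
     (\<forall>p. \<forall>u\<in>tangent_space A p. \<forall>v\<in>tangent_space A p. h p u v = h p v u)"

definition lie_derivative ::
    "('p::topological_space, 'e::euclidean_space) chart set \<Rightarrow> 'p vfield \<Rightarrow> 'p tensor02 \<Rightarrow>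
     'p vfield \<Rightarrow> 'p vfield \<Rightarrow> 'p \<Rightarrow> real" where
  "lie_derivative A X h Y Z p =
     X p (\<lambda>q. h q (Y q) (Z q)) - h p (lie_bracket A X Y p) (Z p) - h p (Y p) (lie_bracket A X Z p)"

section \<open>Riemannian metrics\<close>

definition riemannian_metric ::
    "('p::topological_space, 'e::euclidean_space) chart set \<Rightarrow> 'p tensor02 \<Rightarrow> bool" where
  "riemannian_metric A g \<longleftrightarrow> symmetric_tensor_field A g \<and>
     (\<forall>p. \<forall>u\<in>tangent_space A p. u \<noteq> 0 \<longrightarrow> g p u u > 0)"

definition smooth_curve ::
    "('p::topological_space, 'e::euclidean_space) chart set \<Rightarrow> real set \<Rightarrow> (real \<Rightarrow> 'p) \<Rightarrow> bool" where
  "smooth_curve A J \<gamma> \<longleftrightarrow> continuous_on J \<gamma> \<and>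
     (\<forall>(U, \<phi>)\<in>A. smooth_on (J \<inter> \<gamma> -` U) (\<phi> \<circ> \<gamma>))"

definition velocity ::
    "('p::topological_space, 'e::euclidean_space) chart set \<Rightarrow> (real \<Rightarrow> 'p) \<Rightarrow> real \<Rightarrow> 'p tvec" where
  "velocity A \<gamma> s = (\<lambda>f. if smooth_at A (\<gamma> s) f then deriv (\<lambda>r. f (\<gamma> r)) s else 0)"

definition curve_length ::
    "('p::topological_space, 'e::euclidean_space) chart set \<Rightarrow> 'p tensor02 \<Rightarrow> (real \<Rightarrow> 'p) \<Rightarrow> real" where
  "curve_length A g \<gamma> =
     integral {0..1} (\<lambda>s. sqrt (g (\<gamma> s) (velocity A \<gamma> s) (velocity A \<gamma> s)))"

text \<open>
  The velocity of a curve may vanish, so corners can be parametrised smoothly and the infimum over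
  smooth curves is the one over piecewise smooth curves.
\<close>

definition riemannian_dist ::
    "('p::topological_space, 'e::euclidean_space) chart set \<Rightarrow> 'p tensor02 \<Rightarrow> 'p \<Rightarrow> 'p \<Rightarrow> real" where
  "riemannian_dist A g p q = Inf {curve_length A g \<gamma> | \<gamma>.
     (\<exists>J. open J \<and> {0..1} \<subseteq> J \<and> smooth_curve A J \<gamma>) \<and> \<gamma> 0 = p \<and> \<gamma> 1 = q}"

definition complete_metric ::
    "('p::topological_space, 'e::euclidean_space) chart set \<Rightarrow> 'p tensor02 \<Rightarrow> bool" where
  "complete_metric A g \<longleftrightarrow>
     (\<forall>\<sigma>. (\<forall>\<epsilon>>0. \<exists>N. \<forall>i\<ge>N. \<forall>j\<ge>N. riemannian_dist A g (\<sigma> i) (\<sigma> j) < \<epsilon>) \<longrightarrow> (\<exists>p. \<sigma> \<longlonglongrightarrow> p))"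

section \<open>The Levi-Civita connection\<close>

text \<open>
  Connections act on the vector fields of every open set. Locality need not be required: for
  \<open>X \<in> vfields A U\<close> multiplication by the indicator function of \<open>U\<close> shows that \<open>D X Y\<close> on \<open>U\<close> is
  determined by \<open>X\<close> and \<open>Y\<close> on \<open>U\<close>.
\<close>

definition affine_connection ::
    "('p::topological_space, 'e::euclidean_space) chart set \<Rightarrow>
     ('p vfield \<Rightarrow> 'p vfield \<Rightarrow> 'p vfield) \<Rightarrow> bool" where
  "affine_connection A D \<longleftrightarrow>
     (\<forall>U. open U \<longrightarrow> (\<forall>X\<in>vfields A U. \<forall>Y\<in>vfields A U. D X Y \<in> vfields A U \<and>
        (\<forall>Z\<in>vfields A U. \<forall>p\<in>U. D (X + Z) Y p = D X Y p + D Z Y p \<and>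
           D X (Y + Z) p = D X Y p + D X Z p) \<and>
        (\<forall>f. smooth_fun A U f \<longrightarrow> (\<forall>p\<in>U. D (fscale f X) Y p = f p *\<^sub>T D X Y p \<and>
           D X (fscale f Y) p = X p f *\<^sub>T Y p + f p *\<^sub>T D X Y p))))"

definition is_levi_civita ::
    "('p::topological_space, 'e::euclidean_space) chart set \<Rightarrow> 'p tensor02 \<Rightarrow>
     ('p vfield \<Rightarrow> 'p vfield \<Rightarrow> 'p vfield) \<Rightarrow> bool" where
  "is_levi_civita A g D \<longleftrightarrow> affine_connection A D \<and>
     (\<forall>U. open U \<longrightarrow> (\<forall>X\<in>vfields A U. \<forall>Y\<in>vfields A U. \<forall>p\<in>U.
        D X Y p - D Y X p = lie_bracket A X Y p \<and>
        (\<forall>Z\<in>vfields A U. X p (\<lambda>q. g q (Y q) (Z q)) = g p (D X Y p) (Z p) + g p (Y p) (D X Z p))))"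

text \<open>The choice only concerns the irrelevant values at points near which \<open>X\<close> or \<open>Y\<close> is not smooth.\<close>

definition levi_civita ::
    "('p::topological_space, 'e::euclidean_space) chart set \<Rightarrow> 'p tensor02 \<Rightarrow>
     'p vfield \<Rightarrow> 'p vfield \<Rightarrow> 'p vfield" where
  "levi_civita A g = (SOME D. is_levi_civita A g D)"

section \<open>Foliations\<close>

text \<open>
  A foliation with \<open>CARD('m)\<close>-dimensional leaves is given by a foliated atlas \<open>F\<close>, smoothly
  compatible with \<open>A\<close>. The leaves are locally the level sets of the transverse coordinates
  \<open>fst \<circ> \<phi>\<close> of its charts, hence the vectors tangent to the leaves are those annihilating the
  transverse coordinates.
\<close>

definition foliation ::
    "('p::{t2_space,second_countable_topology}, (real^'n::finite) \<times> (real^'m::finite)) chart set \<Rightarrow>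
     ('p, (real^'n::finite) \<times> (real^'m::finite)) chart set \<Rightarrow> bool" where
  "foliation A F \<longleftrightarrow> smooth_atlas F \<and> smooth_atlas (A \<union> F) \<and>
     (\<forall>(U, \<phi>)\<in>F. \<forall>(V, \<psi>)\<in>F. \<forall>p\<in>U \<inter> V.
        \<exists>W \<eta>. open W \<and> p \<in> W \<and> W \<subseteq> U \<inter> V \<and> (\<forall>q\<in>W. fst (\<psi> q) = \<eta> (fst (\<phi> q))))"

definition vertical ::
    "('p::topological_space, (real^'n::finite) \<times> (real^'m::finite)) chart set \<Rightarrow>
     ('p, (real^'n::finite) \<times> (real^'m::finite)) chart set \<Rightarrow> 'p \<Rightarrow> 'p tvec set" where
  "vertical A F p = {v \<in> tangent_space A p.
     \<forall>(U, \<phi>)\<in>F. p \<in> U \<longrightarrow> (\<forall>i. v (\<lambda>q. fst (\<phi> q) $ i) = 0)}"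

definition horizontal ::
    "('p::topological_space, (real^'n::finite) \<times> (real^'m::finite)) chart set \<Rightarrow>
     ('p, (real^'n::finite) \<times> (real^'m::finite)) chart set \<Rightarrow> 'p tensor02 \<Rightarrow> 'p \<Rightarrow> 'p tvec set" where
  "horizontal A F g p = {u \<in> tangent_space A p. \<forall>v\<in>vertical A F p. g p u v = 0}"

definition foliate ::
    "('p::topological_space, (real^'n::finite) \<times> (real^'m::finite)) chart set \<Rightarrow>
     ('p, (real^'n::finite) \<times> (real^'m::finite)) chart set \<Rightarrow> 'p set \<Rightarrow> 'p vfield \<Rightarrow> bool" where
  "foliate A F U X \<longleftrightarrow> X \<in> vfields A U \<and>
     (\<forall>W Z. open W \<longrightarrow> W \<subseteq> U \<longrightarrow> Z \<in> sections A (vertical A F) W \<longrightarrow>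
        lie_bracket A X Z \<in> sections A (vertical A F) W)"

definition basic ::
    "('p::topological_space, (real^'n::finite) \<times> (real^'m::finite)) chart set \<Rightarrow>
     ('p, (real^'n::finite) \<times> (real^'m::finite)) chart set \<Rightarrow> 'p tensor02 \<Rightarrow> 'p set \<Rightarrow> 'p vfield \<Rightarrow> bool" where
  "basic A F g U X \<longleftrightarrow> foliate A F U X \<and> X \<in> sections A (horizontal A F g) U"

definition bundle_like ::
    "('p::topological_space, (real^'n::finite) \<times> (real^'m::finite)) chart set \<Rightarrow>
     ('p, (real^'n::finite) \<times> (real^'m::finite)) chart set \<Rightarrow> 'p tensor02 \<Rightarrow> bool" where
  "bundle_like A F g \<longleftrightarrow>
     (\<forall>U X Y Z. open U \<longrightarrow> basic A F g U X \<longrightarrow> basic A F g U Y \<longrightarrow>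
        Z \<in> sections A (vertical A F) U \<longrightarrow> (\<forall>p\<in>U. Z p (\<lambda>q. g q (X q) (Y q)) = 0))"

text \<open>The second fundamental form of the leaves vanishes.\<close>

definition totally_geodesic_leaves ::
    "('p::topological_space, (real^'n::finite) \<times> (real^'m::finite)) chart set \<Rightarrow>
     ('p, (real^'n::finite) \<times> (real^'m::finite)) chart set \<Rightarrow> 'p tensor02 \<Rightarrow> bool" where
  "totally_geodesic_leaves A F g \<longleftrightarrow>
     (\<forall>U. open U \<longrightarrow> (\<forall>Z1\<in>sections A (vertical A F) U. \<forall>Z2\<in>sections A (vertical A F) U.
        \<forall>p\<in>U. levi_civita A g Z1 Z2 p \<in> vertical A F p))"

inductive_set iterated_brackets ::
    "('p::topological_space, 'e::euclidean_space) chart set \<Rightarrow> ('p \<Rightarrow> 'p tvec set) \<Rightarrow>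
     'p set \<Rightarrow> 'p vfield set"
  for A E U where
  base: "X \<in> sections A E U \<Longrightarrow> X \<in> iterated_brackets A E U"
| bracket: "X \<in> iterated_brackets A E U \<Longrightarrow> Y \<in> iterated_brackets A E U \<Longrightarrow>
    lie_bracket A X Y \<in> iterated_brackets A E U"

definition bracket_generating ::
    "('p::topological_space, 'e::euclidean_space) chart set \<Rightarrow> ('p \<Rightarrow> 'p tvec set) \<Rightarrow> bool" where
  "bracket_generating A E \<longleftrightarrow>
     (\<forall>p. \<exists>U. open U \<and> p \<in> U \<and> (\<forall>v\<in>tangent_space A p.
        \<exists>(k::nat) c Y. (\<forall>i<k. Y i \<in> iterated_brackets A E U) \<and> v = (\<Sum>i<k. c i *\<^sub>T Y i p)))"

section \<open>The Bott connection and its horizontal Ricci curvature\<close>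

definition proj_V ::
    "('p::topological_space, (real^'n::finite) \<times> (real^'m::finite)) chart set \<Rightarrow>
     ('p, (real^'n::finite) \<times> (real^'m::finite)) chart set \<Rightarrow> 'p tensor02 \<Rightarrow> 'p \<Rightarrow> 'p tvec \<Rightarrow> 'p tvec" where
  "proj_V A F g p u = (THE v. v \<in> vertical A F p \<and> u - v \<in> horizontal A F g p)"

definition proj_H ::
    "('p::topological_space, (real^'n::finite) \<times> (real^'m::finite)) chart set \<Rightarrow>
     ('p, (real^'n::finite) \<times> (real^'m::finite)) chart set \<Rightarrow> 'p tensor02 \<Rightarrow> 'p \<Rightarrow> 'p tvec \<Rightarrow> 'p tvec" where
  "proj_H A F g p u = u - proj_V A F g p u"

definition bott_connection ::
    "('p::topological_space, (real^'n::finite) \<times> (real^'m::finite)) chart set \<Rightarrow>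
     ('p, (real^'n::finite) \<times> (real^'m::finite)) chart set \<Rightarrow> 'p tensor02 \<Rightarrow> 'p vfield \<Rightarrow> 'p vfield \<Rightarrow> 'p vfield" where
  "bott_connection A F g X Y =
     (let pH = (\<lambda>Z p. proj_H A F g p (Z p)); pV = (\<lambda>Z p. proj_V A F g p (Z p)) in
        pH (levi_civita A g (pH X) (pH Y)) + pH (lie_bracket A (pV X) (pH Y)) +
        pV (lie_bracket A (pH X) (pV Y)) + pV (levi_civita A g (pV X) (pV Y)))"

definition curvature ::
    "('p::topological_space, 'e::euclidean_space) chart set \<Rightarrow>
     ('p vfield \<Rightarrow> 'p vfield \<Rightarrow> 'p vfield) \<Rightarrow> 'p vfield \<Rightarrow> 'p vfield \<Rightarrow> 'p vfield \<Rightarrow> 'p vfield" where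
  "curvature A D X Y Z = D X (D Y Z) - D Y (D X Z) - D (lie_bracket A X Y) Z"

text \<open>By tensoriality the value does not depend on the chosen extensions of the tangent vectors.\<close>

definition curvature_at ::
    "('p::topological_space, 'e::euclidean_space) chart set \<Rightarrow>
     ('p vfield \<Rightarrow> 'p vfield \<Rightarrow> 'p vfield) \<Rightarrow> 'p \<Rightarrow> 'p tvec \<Rightarrow> 'p tvec \<Rightarrow> 'p tvec \<Rightarrow> 'p tvec" where
  "curvature_at A D p u v w = (SOME r. \<exists>U X Y Z. open U \<and> p \<in> U \<and>
     X \<in> vfields A U \<and> Y \<in> vfields A U \<and> Z \<in> vfields A U \<and>
     X p = u \<and> Y p = v \<and> Z p = w \<and> r = curvature A D X Y Z p)"

text \<open>
  The trace over the horizontal space, which has dimension \<open>CARD('n)\<close>, is computed in an arbitrary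
  orthonormal basis. The sign is such that round spheres have positive Ricci curvature.
\<close>

definition ric_H ::
    "('p::topological_space, (real^'n::finite) \<times> (real^'m::finite)) chart set \<Rightarrow>
     ('p, (real^'n::finite) \<times> (real^'m::finite)) chart set \<Rightarrow> 'p tensor02 \<Rightarrow> 'p tensor02" where
  "ric_H A F g p u v =
     (let E = (SOME E :: 'n \<Rightarrow> 'p tvec.
        (\<forall>i. E i \<in> horizontal A F g p) \<and> (\<forall>i j. g p (E i) (E j) = (if i = j then 1 else 0)))
      in \<Sum>i\<in>UNIV. g p (curvature_at A (bott_connection A F g) p (E i)
           (proj_H A F g p u) (proj_H A F g p v)) (E i))"

section \<open>The transverse flow\<close>

definition transverse_tensor ::
    "('p::topological_space, (real^'n::finite) \<times> (real^'m::finite)) chart set \<Rightarrow>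
     ('p, (real^'n::finite) \<times> (real^'m::finite)) chart set \<Rightarrow> 'p tensor02 \<Rightarrow> bool" where
  "transverse_tensor A F h \<longleftrightarrow> symmetric_tensor_field A h \<and>
     (\<forall>U. open U \<longrightarrow> (\<forall>X\<in>vfields A U. \<forall>Z\<in>vfields A U.
        X \<in> sections A (vertical A F) U \<or> Z \<in> sections A (vertical A F) U \<longrightarrow>
        (\<forall>p\<in>U. h p (X p) (Z p) = 0)))"

text \<open>
  The horizontal bundle is that of \<open>g0\<close>. The splitting \<open>g(t) = g\<^sub>H(t) \<oplus> g\<^sub>V\<close> is the orthogonality of
  the horizontal and the vertical bundle for every \<open>g(t)\<close>; \<open>g\<^sub>H(t)\<close> and \<open>g\<^sub>V\<close> are the restrictions
  of \<open>g(t)\<close> to these bundles.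
\<close>

definition transverse_flow ::
    "('p::topological_space, (real^'n::finite) \<times> (real^'m::finite)) chart set \<Rightarrow>
     ('p, (real^'n::finite) \<times> (real^'m::finite)) chart set \<Rightarrow> 'p tensor02 \<Rightarrow> real set \<Rightarrow>
     (real \<Rightarrow> 'p tensor02) \<Rightarrow> (real \<Rightarrow> 'p tensor02) \<Rightarrow> bool" where
  "transverse_flow A F g0 I g h \<longleftrightarrow>
     is_interval I \<and> 0 \<in> I \<and> g 0 = g0 \<and>
     (\<forall>t\<in>I. riemannian_metric A (g t)) \<and>
     (\<forall>t\<in>I. \<forall>p. \<forall>u\<in>horizontal A F g0 p. \<forall>v\<in>vertical A F p. g t p u v = 0) \<and>
     (\<forall>t\<in>I. \<forall>p. \<forall>u\<in>horizontal A F g0 p. \<forall>v\<in>horizontal A F g0 p.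
        ((\<lambda>s. g s p u v) has_real_derivative h t p u v) (at t within I)) \<and>
     (\<forall>t\<in>I. \<forall>p. \<forall>u\<in>vertical A F p. \<forall>v\<in>vertical A F p.
        ((\<lambda>s. g s p u v) has_real_derivative 0) (at t within I))"

end

theory Submission
  imports Defs
begin

text \<open>
  For vertical \<open>Z\<^sub>1, Z\<^sub>2\<close> and horizontal \<open>X\<close>, all terms of the Koszul formula for
  \<open>2 g(\<nabla>\<^sub>Z\<^sub>1 Z\<^sub>2, X)\<close> vanish except
  \<open>- X g(Z\<^sub>1, Z\<^sub>2) - g([Z\<^sub>1, X], Z\<^sub>2) - g([Z\<^sub>2, X], Z\<^sub>1) = - (\<L>\<^sub>X g)(Z\<^sub>1, Z\<^sub>2)\<close>. This expression involves
  \<open>g\<close> only through the splitting and the vertical metric, and the flow changes neither; so it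
  vanishes for \<open>g(t)\<close> because it does for \<open>g\<^sub>0\<close>.

  As \<^const>\<open>levi_civita\<close> is defined by choice, the existence of the Levi-Civita connection has to
  be proved. The Koszul formula determines it through local orthogonal frames, which are obtained
  from coordinate frames by the Gram-Schmidt process; that the coordinate vectors span the space of
  derivations is Hadamard's lemma. In a foliated chart, with the leaf directions taken first, the
  same process yields frames adapted to the splitting.
\<close>

section \<open>Calculus of smooth maps on open sets\<close>

text \<open>The Koszul expression defines a vector because it is linear over functions in its third
  argument: its values on an orthogonal frame then determine it on every field. The laws of a
  connection follow by testing both sides against local fields, and the frame formula gives
  smoothness. Frames are kept orthogonal but not normalised, so that all coefficients are quotients
  of smooth functions.

  The obstacle in comparing two metrics is that a horizontal vector is extended to a field
  \<open>X\<close> that is merely horizontal, so [Z, X] need not be vertical for vertical Z. The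
  bracket is therefore split; its horizontal part pairs to zero with vertical vectors for both
  metrics. The vector to test against is the horizontal part of the new covariant derivative itself:
  the test then says that this part has length zero.\<close>

lemma frechet_derivative_cong_open:
  assumes "open S" "x \<in> S" "\<And>y. y \<in> S \<Longrightarrow> f y = g y"
  shows "frechet_derivative f (at x) = frechet_derivative g (at x)"
proof -
  \<comment> \<open>Equivalence for every candidate \<open>D\<close> makes the choice inside
    \<open>frechet_derivative\<close> agree even at points where neither function is
    differentiable.\<close>
  have "(f has_derivative D) (at x) \<longleftrightarrow> (g has_derivative D) (at x)" for D
    using has_derivative_transform_within_open[of f D x UNIV S g]
      has_derivative_transform_within_open[of g D x UNIV S f] assms by auto
  then show ?thesis
    by (simp add: frechet_derivative_def)
qed

lemma Ck_on_cong:
  assumes "open S" "\<And>x. x \<in> S \<Longrightarrow> f x = g x" "Ck_on k S f"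
  shows "Ck_on k S g"
  using assms(2,3)
proof (induction k arbitrary: f g)
  case 0
  then show ?case by (auto cong: continuous_on_cong)
next
  case (Suc k)
  have "g differentiable (at x)" if x: "x \<in> S" for x
  proof -
    obtain D where D: "(f has_derivative D) (at x)"
      using Suc.prems x by (auto simp: differentiable_def)
    have "(g has_derivative D) (at x)"
      by (rule has_derivative_transform_within_open[OF D assms(1) x Suc.prems(1)])
    then show ?thesis
      by (auto simp: differentiable_def)
  qed
  moreover have "Ck_on k S (\<lambda>x. frechet_derivative g (at x) b)" if "b \<in> Basis" for b
    by (rule Suc.IH[of "\<lambda>x. frechet_derivative f (at x) b"])
      (use Suc.prems that frechet_derivative_cong_open[OF assms(1), of _ f g] in auto)
  ultimately show ?case by simp
qed

text \<open>Derivatives are taken in the whole space, not within \<open>S\<close>, so shrinking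
  \<open>S\<close> leaves them unchanged.\<close>

lemma Ck_on_subset: "Ck_on k S f \<Longrightarrow> T \<subseteq> S \<Longrightarrow> Ck_on k T f"
  by (induction k arbitrary: f) (auto intro: continuous_on_subset)

lemma Ck_on_local:
  assumes "\<And>x. x \<in> S \<Longrightarrow> \<exists>T. open T \<and> x \<in> T \<and> Ck_on k T f"
  shows "Ck_on k S f"
  using assms
proof (induction k arbitrary: f)
  case 0
  show ?case
    unfolding Ck_on.simps
  proof (rule continuous_at_imp_continuous_on, intro ballI)
    fix x assume "x \<in> S"
    with 0 obtain T where "open T" "x \<in> T" "continuous_on T f" by auto
    then show "isCont f x" by (simp add: continuous_on_eq_continuous_at)
  qed
next
  case (Suc k)
  have "\<exists>T. open T \<and> x \<in> T \<and> Ck_on k T (\<lambda>x. frechet_derivative f (at x) b)"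
    if "x \<in> S" "b \<in> Basis" for x b
    using Suc.prems[OF that(1)] that(2) by auto
  then show ?case
    using Suc.IH Suc.prems by fastforce
qed

lemma Ck_on_SucD: "Ck_on (Suc k) S f \<Longrightarrow> Ck_on k S f"
proof (induction k arbitrary: f)
  case 0
  then show ?case
    by (auto intro!: continuous_at_imp_continuous_on differentiable_imp_continuous_within)
qed auto

lemma Ck_on_continuous: "Ck_on k S f \<Longrightarrow> continuous_on S f"
  by (induction k) (use Ck_on_SucD in fastforce)+

text \<open>Lets the calculus rules supply the derivative; uniqueness identifies it with the one
  chosen by \<open>frechet_derivative\<close>.\<close>

lemma Ck_on_SucI:
  assumes "open S" "\<And>x. x \<in> S \<Longrightarrow> (f has_derivative f' x) (at x)"
    "\<And>b. b \<in> Basis \<Longrightarrow> Ck_on k S (\<lambda>x. f' x b)"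
  shows "Ck_on (Suc k) S f"
proof -
  have "f' x = frechet_derivative f (at x)" if "x \<in> S" for x
    using frechet_derivative_at assms(2) that by blast
  then have "Ck_on k S (\<lambda>x. frechet_derivative f (at x) b)" if "b \<in> Basis" for b
    using Ck_on_cong[OF assms(1) _ assms(3)[OF that], of "\<lambda>x. frechet_derivative f (at x) b"] by simp
  then show ?thesis
    using assms(2) by (auto simp: differentiable_def)
qed

lemma Ck_on_SucE:
  assumes "Ck_on (Suc k) S f" "x \<in> S"
  shows "(f has_derivative frechet_derivative f (at x)) (at x)"
  using assms frechet_derivative_works by auto

lemma Ck_on_const: "Ck_on k S (\<lambda>x. c)"
proof (induction k arbitrary: c)
  case (Suc k)
  then show ?case by (simp add: frechet_derivative_const)
qed simp

lemma Ck_on_bounded_linear: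
  assumes "open S" "bounded_linear L" "Ck_on k S f"
  shows "Ck_on k S (\<lambda>x. L (f x))"
  using assms(3)
proof (induction k arbitrary: f)
  case 0
  then show ?case
    using bounded_linear.continuous_on[OF assms(2)] by auto
next
  case (Suc k)
  show ?case
    by (rule Ck_on_SucI[OF assms(1) bounded_linear.has_derivative[OF assms(2) Ck_on_SucE[OF Suc.prems]]])
      (use Suc in auto)
qed

lemma Ck_on_id: "open S \<Longrightarrow> Ck_on k S (\<lambda>x. x)"
  by (cases k) (auto intro!: Ck_on_SucI[where f' = "\<lambda>_ h. h"] Ck_on_const)

lemma Ck_on_add:
  assumes "open S" "Ck_on k S f" "Ck_on k S g"
  shows "Ck_on k S (\<lambda>x. f x + g x)"
  using assms(2,3)
proof (induction k arbitrary: f g)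
  case 0
  then show ?case by (auto intro: continuous_on_add)
next
  case (Suc k)
  show ?case
    by (rule Ck_on_SucI[OF assms(1) has_derivative_add[OF Ck_on_SucE[OF Suc.prems(1)] Ck_on_SucE[OF Suc.prems(2)]]])
      (use Suc in auto)
qed

lemma Ck_on_sum:
  assumes "open S" "\<And>i. i \<in> J \<Longrightarrow> Ck_on k S (f i)"
  shows "Ck_on k S (\<lambda>x. \<Sum>i\<in>J. f i x)"
  using assms(2) by (induction J rule: infinite_finite_induct)
    (auto intro: Ck_on_const Ck_on_add[OF assms(1)])

text \<open>By the Leibniz rule the derivative is again a sum of values of \<open>B\<close>, so the
  induction closes; the undifferentiated factors are weakened by one order with
  \<open>Ck_on_SucD\<close>.\<close>

lemma Ck_on_bounded_bilinear:
  assumes "open S" "bounded_bilinear B" "Ck_on k S f" "Ck_on k S g"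
  shows "Ck_on k S (\<lambda>x. B (f x) (g x))"
  using assms(3,4)
proof (induction k arbitrary: f g)
  case 0
  then show ?case
    using bounded_bilinear.continuous_on[OF assms(2)] by auto
next
  case (Suc k)
  show ?case
  proof (rule Ck_on_SucI[OF assms(1) bounded_bilinear.FDERIV[OF assms(2)
          Ck_on_SucE[OF Suc.prems(1)] Ck_on_SucE[OF Suc.prems(2)]]])
    fix b :: 'a assume "b \<in> Basis"
    then show "Ck_on k S (\<lambda>x. B (f x) (frechet_derivative g (at x) b) +
        B (frechet_derivative f (at x) b) (g x))"
      using Suc.prems Suc.prems[THEN Ck_on_SucD] by (intro Ck_on_add assms(1) Suc.IH) auto
  qed
qed

text \<open>The derivative of 1/f is -(1/f) f' (1/f), in which 1/f is needed only to one order
  less.\<close>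

lemma Ck_on_inverse:
  fixes f :: "'a::euclidean_space \<Rightarrow> real"
  assumes "open S" "\<And>x. x \<in> S \<Longrightarrow> f x \<noteq> 0" "Ck_on k S f"
  shows "Ck_on k S (\<lambda>x. inverse (f x))"
  using assms(3)
proof (induction k)
  case 0
  then show ?case
    using assms(2) by (auto intro: continuous_on_inverse)
next
  case (Suc k)
  note mult = Ck_on_bounded_bilinear[OF assms(1) bounded_bilinear_mult]
  have IH: "Ck_on k S (\<lambda>x. inverse (f x))"
    using Suc Ck_on_SucD by blast
  show ?case
  proof (rule Ck_on_SucI[OF assms(1) Deriv.has_derivative_inverse[OF assms(2) Ck_on_SucE[OF Suc.prems]]])
    fix b :: 'a assume "b \<in> Basis"
    then have "Ck_on k S (\<lambda>x. inverse (f x) * frechet_derivative f (at x) b * inverse (f x))"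
      using Suc.prems by (intro mult IH) auto
    then show "Ck_on k S (\<lambda>x. - (inverse (f x) * frechet_derivative f (at x) b * inverse (f x)))"
      by (rule Ck_on_bounded_linear[OF assms(1) bounded_linear_minus[OF bounded_linear_ident]])
  qed auto
qed

lemma Ck_on_compose:
  fixes f :: "'a::euclidean_space \<Rightarrow> 'b::euclidean_space" and g :: "'b \<Rightarrow> 'c::real_normed_vector"
  assumes "open S" "open T" "f ` S \<subseteq> T" "Ck_on k S f" "Ck_on k T g"
  shows "Ck_on k S (\<lambda>x. g (f x))"
  using assms(4,5)
proof (induction k arbitrary: g)
  case 0
  then show ?case
    using assms(3) by (auto intro: continuous_on_compose2)
next
  case (Suc k)
  have der: "((\<lambda>x. g (f x)) has_derivative
      (\<lambda>h. frechet_derivative g (at (f x)) (frechet_derivative f (at x) h))) (at x)" if "x \<in> S" for x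
    using has_derivative_compose[OF Ck_on_SucE[OF Suc.prems(1) that] Ck_on_SucE[OF Suc.prems(2)]]
      that assms(3) by (auto simp: o_def)
  show ?case
  proof (rule Ck_on_SucI[OF assms(1) der])
    fix b :: 'a assume b: "b \<in> Basis"
    \<comment> \<open>The chain rule feeds the derivative of \<open>g\<close> a direction that
      varies with \<open>x\<close>, while \<open>Ck_on\<close> controls basis directions only.
      Expanding in the basis gives a sum of products to which the induction hypothesis
      applies.\<close>
    have expand: "(\<Sum>c\<in>Basis. (frechet_derivative f (at x) b \<bullet> c) *\<^sub>R frechet_derivative g (at (f x)) c)
        = frechet_derivative g (at (f x)) (frechet_derivative f (at x) b)" if "x \<in> S" for x
    proof -
      have lin: "linear (frechet_derivative g (at (f x)))"
        using Suc.prems(2) assms(3) that by (auto intro!: linear_frechet_derivative)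
      show ?thesis
        by (subst (2) euclidean_representation[of "frechet_derivative f (at x) b", symmetric])
          (simp only: linear_sum[OF lin] linear_cmul[OF lin])
    qed
    have "Ck_on k S (\<lambda>x. \<Sum>c\<in>Basis. (frechet_derivative f (at x) b \<bullet> c) *\<^sub>R frechet_derivative g (at (f x)) c)"
    proof (intro Ck_on_sum Ck_on_bounded_bilinear[OF assms(1) bounded_bilinear_scaleR] assms(1))
      fix c :: 'b assume c: "c \<in> Basis"
      show "Ck_on k S (\<lambda>x. frechet_derivative f (at x) b \<bullet> c)"
        using Suc.prems(1) b by (intro Ck_on_bounded_linear[OF assms(1) bounded_linear_inner_left]) auto
      show "Ck_on k S (\<lambda>x. frechet_derivative g (at (f x)) c)"
        using Suc.IH[of "\<lambda>y. frechet_derivative g (at y) c"] Suc.prems c Ck_on_SucD[OF Suc.prems(1)]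
        by simp
    qed
    then show "Ck_on k S (\<lambda>x. frechet_derivative g (at (f x)) (frechet_derivative f (at x) b))"
      by (rule Ck_on_cong[OF assms(1), rotated]) (rule expand)
  qed
qed

text \<open>Differentiation under the integral sign produces one more factor \<open>t\<close> each
  time, so the induction has to run over all exponents \<open>j\<close>; Hadamard's lemma uses
  \<open>j = 0\<close>.\<close>

lemma Ck_on_integral_segment:
  fixes F :: "'a::euclidean_space \<Rightarrow> real"
  assumes "open S" "convex S" "a \<in> S" "Ck_on k S F"
  shows "Ck_on k S (\<lambda>x. integral (cbox 0 1) (\<lambda>t::real. t ^ j * F (a + t *\<^sub>R (x - a))))"
  using assms(4)
proof (induction k arbitrary: F j)
  case 0
  have seg: "a + t *\<^sub>R (x - a) \<in> S" if "x \<in> S" "0 \<le> t" "t \<le> 1" for x and t :: real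
    using convexD_alt[OF assms(2,3) that] by (simp add: algebra_simps)
  have "continuous_on (S \<times> cbox 0 1) (\<lambda>(x, t::real). t ^ j * F (a + t *\<^sub>R (x - a)))"
    unfolding case_prod_beta using 0 seg
    by (auto intro!: continuous_intros continuous_on_compose2[of S F])
  then show ?case
    unfolding Ck_on.simps by (rule integral_continuous_on_param)
next
  case (Suc k)
  have seg: "a + t *\<^sub>R (x - a) \<in> S" if "x \<in> S" "0 \<le> t" "t \<le> 1" for x and t :: real
    using convexD_alt[OF assms(2,3) that] by (simp add: algebra_simps)
  define F' where "F' y = frechet_derivative F (at y)" for y
  have F': "(F has_derivative F' y) (at y)" if "y \<in> S" for y
    using Ck_on_SucE[OF Suc.prems that] by (simp add: F'_def)
  have contF': "continuous_on S (\<lambda>y. F' y b)" if "b \<in> Basis" for b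
    using Suc.prems that Ck_on_continuous[of k S "\<lambda>y. F' y b"] unfolding F'_def by simp
  \<comment> \<open>\<open>leibniz_rule\<close> asks for the derivative as a continuous family of
    bounded linear maps. For \<open>x\<close> in \<open>S\<close> and \<open>t\<close> in [0,1] the
    point lies in \<open>S\<close>, and \<open>Blinfun\<close> there has the intended value.\<close>
  define D where "D x t = Blinfun (\<lambda>h. t ^ Suc j * F' (a + t *\<^sub>R (x - a)) h)" for x and t :: real
  have D: "blinfun_apply (D x t) = (\<lambda>h. t ^ Suc j * F' (a + t *\<^sub>R (x - a)) h)"
    if "x \<in> S" "0 \<le> t" "t \<le> 1" for x t
    unfolding D_def using has_derivative_bounded_linear[OF F'[OF seg[OF that]]]
    by (intro bounded_linear_Blinfun_apply bounded_linear_const_mult)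
  have der1: "((\<lambda>x. t ^ j * F (a + t *\<^sub>R (x - a))) has_derivative D x t) (at x within S)"
    if "x \<in> S" "t \<in> cbox 0 1" for x t
  proof -
    have t: "0 \<le> t" "t \<le> 1" using that by auto
    have inner: "((\<lambda>x. a + t *\<^sub>R (x - a)) has_derivative (\<lambda>h. t *\<^sub>R h)) (at x)"
      by (auto intro!: derivative_eq_intros)
    note F1 = has_derivative_compose[OF inner F'[OF seg[OF that(1) t]]]
    have "((\<lambda>x. t ^ j * F (a + t *\<^sub>R (x - a))) has_derivative
        (\<lambda>h. t ^ j * F' (a + t *\<^sub>R (x - a)) (t *\<^sub>R h))) (at x)"
      by (intro has_derivative_mult_right F1)
    moreover have "F' (a + t *\<^sub>R (x - a)) (t *\<^sub>R h) = t * F' (a + t *\<^sub>R (x - a)) h" for h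
      using linear_cmul[OF has_derivative_linear[OF F'[OF seg[OF that(1) t]]]] by simp
    ultimately show ?thesis
      unfolding D[OF that(1) t] by (auto intro: has_derivative_at_withinI simp: algebra_simps)
  qed
  have Dcont: "continuous_on (S \<times> cbox 0 1) (\<lambda>(x, t). D x t)"
    unfolding case_prod_beta
  proof (rule continuous_on_blinfun_componentwise)
    fix b :: 'a assume b: "b \<in> Basis"
    have "continuous_on (S \<times> cbox 0 1)
        (\<lambda>p. snd p ^ Suc j * F' (a + snd p *\<^sub>R (fst p - a)) b)"
      using seg by (auto intro!: continuous_intros continuous_on_compose2[OF contF'[OF b]])
    then show "continuous_on (S \<times> cbox 0 1) (\<lambda>p. blinfun_apply (D (fst p) (snd p)) b)"
      by (rule continuous_on_eq) (auto simp: D)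
  qed
  have int1: "(\<lambda>t. t ^ j * F (a + t *\<^sub>R (x - a))) integrable_on cbox 0 1" if "x \<in> S" for x
    using seg[OF that]
    by (intro integrable_continuous continuous_intros
        continuous_on_compose2[OF Ck_on_continuous[OF Suc.prems]]) auto
  have intD: "D x integrable_on cbox 0 1" if "x \<in> S" for x
  proof (rule integrable_continuous)
    have "continuous_on (cbox 0 1) (\<lambda>t::real. (x, t))"
      by (intro continuous_intros)
    then show "continuous_on (cbox 0 1) (D x)"
      using continuous_on_compose2[OF Dcont, of "cbox 0 1" "\<lambda>t. (x, t)"] that by auto
  qed
  show ?case
  proof (rule Ck_on_SucI[OF assms(1)])
    fix x assume x: "x \<in> S"
    show "((\<lambda>x. integral (cbox 0 1) (\<lambda>t. t ^ j * F (a + t *\<^sub>R (x - a)))) has_derivative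
        blinfun_apply (integral (cbox 0 1) (D x))) (at x)"
      using leibniz_rule[OF der1 int1 Dcont x assms(2)] at_within_open[OF x assms(1)] by simp
  next
    fix b :: 'a assume b: "b \<in> Basis"
    have IH: "Ck_on k S (\<lambda>x. integral (cbox 0 1) (\<lambda>t. t ^ Suc j * F' (a + t *\<^sub>R (x - a)) b))"
      by (rule Suc.IH) (use Suc.prems b in \<open>auto simp: F'_def\<close>)
    have eq: "integral (cbox 0 1) (\<lambda>t. t ^ Suc j * F' (a + t *\<^sub>R (x - a)) b)
        = blinfun_apply (integral (cbox 0 1) (D x)) b" if x: "x \<in> S" for x
      unfolding blinfun_apply_integral[OF intD[OF x]]
      by (rule integral_cong) (use x in \<open>auto simp: D\<close>)
    from assms(1) eq IH show "Ck_on k S (\<lambda>x. blinfun_apply (integral (cbox 0 1) (D x)) b)"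
      by (rule Ck_on_cong)
  qed
qed

text \<open>The function \<open>g b\<close> is the mean of the partial derivative of
  \<open>f\<close> over the segment from \<open>a\<close> to \<open>x\<close>, which convexity keeps
  inside \<open>S\<close>. The fundamental theorem of calculus along the segment gives the
  expansion.\<close>

lemma hadamard_lemma:
  fixes f :: "'a::euclidean_space \<Rightarrow> real"
  assumes "open S" "convex S" "a \<in> S" "smooth_on S f"
  obtains g where "\<And>b. b \<in> Basis \<Longrightarrow> smooth_on S (g b)"
    and "\<And>x. x \<in> S \<Longrightarrow> f x = f a + (\<Sum>b\<in>Basis. ((x - a) \<bullet> b) * g b x)"
    and "\<And>b. b \<in> Basis \<Longrightarrow> g b a = frechet_derivative f (at a) b"
proof
  define f' where "f' y = frechet_derivative f (at y)" for y
  \<comment> \<open>The factor \<open>t ^ 0\<close> gives the integrand the shape of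
    \<open>Ck_on_integral_segment\<close>.\<close>
  define g where "g b x = integral (cbox 0 1) (\<lambda>t::real. t ^ 0 * f' (a + t *\<^sub>R (x - a)) b)" for b x
  have f': "(f has_derivative f' y) (at y)" if "y \<in> S" for y
  proof -
    have "Ck_on (Suc 0) S f"
      using assms(4) unfolding smooth_on_def by blast
    from Ck_on_SucE[OF this that] show ?thesis
      by (simp add: f'_def)
  qed
  have Ck: "Ck_on k S (\<lambda>y. f' y b)" if "b \<in> Basis" for b k
  proof -
    have "Ck_on (Suc k) S f"
      using assms(4) unfolding smooth_on_def by blast
    then show ?thesis
      using that by (simp add: f'_def)
  qed
  show "smooth_on S (g b)" if "b \<in> Basis" for b
    unfolding smooth_on_def g_def using Ck_on_integral_segment[OF assms(1-3) Ck[OF that]] by blast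
  show "g b a = frechet_derivative f (at a) b" if "b \<in> Basis" for b
    by (simp add: g_def f'_def)
  fix x assume x: "x \<in> S"
  have seg: "a + t *\<^sub>R (x - a) \<in> S" if "0 \<le> t" "t \<le> 1" for t
    using convexD_alt[OF assms(2,3) x that] by (simp add: algebra_simps)
  have "((\<lambda>t. f' (a + t *\<^sub>R (x - a)) (x - a)) has_integral
      f (a + 1 *\<^sub>R (x - a)) - f (a + 0 *\<^sub>R (x - a))) {0..1}"
  proof (rule fundamental_theorem_of_calculus)
    fix t :: real assume t: "t \<in> {0..1}"
    have "((\<lambda>t. a + t *\<^sub>R (x - a)) has_vector_derivative x - a) (at t within {0..1})"
      by (auto intro!: derivative_eq_intros simp: has_vector_derivative_def)
    from vector_derivative_diff_chain_within[OF this has_derivative_at_withinI[OF f'[OF seg]]] t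
    show "((\<lambda>t. f (a + t *\<^sub>R (x - a))) has_vector_derivative f' (a + t *\<^sub>R (x - a)) (x - a))
        (at t within {0..1})"
      by (auto simp: o_def)
  qed simp
  then have *: "f x - f a = integral {0..1} (\<lambda>t. f' (a + t *\<^sub>R (x - a)) (x - a))"
    by (simp add: integral_unique)
  have "integral {0..1} (\<lambda>t. f' (a + t *\<^sub>R (x - a)) (x - a))
      = integral {0..1} (\<lambda>t. \<Sum>b\<in>Basis. ((x - a) \<bullet> b) * f' (a + t *\<^sub>R (x - a)) b)"
  proof (rule integral_cong)
    fix t :: real assume "t \<in> {0..1}"
    then have lin: "linear (f' (a + t *\<^sub>R (x - a)))"
      using has_derivative_linear[OF f'[OF seg]] by auto
    show "f' (a + t *\<^sub>R (x - a)) (x - a) = (\<Sum>b\<in>Basis. ((x - a) \<bullet> b) * f' (a + t *\<^sub>R (x - a)) b)"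
      by (subst euclidean_representation[of "x - a", symmetric])
        (simp add: linear_sum[OF lin] linear_cmul[OF lin])
  qed
  also have "\<dots> = (\<Sum>b\<in>Basis. integral {0..1} (\<lambda>t. ((x - a) \<bullet> b) * f' (a + t *\<^sub>R (x - a)) b))"
  proof (intro integral_sum)
    fix b :: 'a assume b: "b \<in> Basis"
    show "(\<lambda>t. ((x - a) \<bullet> b) * f' (a + t *\<^sub>R (x - a)) b) integrable_on {0..1}"
    proof (intro integrable_continuous_interval continuous_on_mult continuous_on_const)
      show "continuous_on {0..1} (\<lambda>t. f' (a + t *\<^sub>R (x - a)) b)"
        using seg by (intro continuous_on_compose2[OF Ck_on_continuous[OF Ck[OF b, of 0]]])
          (auto intro!: continuous_intros)
    qed
  qed simp
  finally show "f x = f a + (\<Sum>b\<in>Basis. ((x - a) \<bullet> b) * g b x)"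
    using * by (simp add: g_def)
qed

section \<open>From finite order of differentiability to smoothness\<close>

lemma smooth_on_cong:
  assumes "open S" "\<And>x. x \<in> S \<Longrightarrow> f x = g x" "smooth_on S f"
  shows "smooth_on S g"
  unfolding smooth_on_def
proof
  fix k
  show "Ck_on k S g"
    by (rule Ck_on_cong[OF assms(1,2)]) (use assms(3) in \<open>auto simp: smooth_on_def\<close>)
qed

lemma smooth_on_subset: "smooth_on S f \<Longrightarrow> T \<subseteq> S \<Longrightarrow> smooth_on T f"
  unfolding smooth_on_def by (blast intro: Ck_on_subset)

lemma smooth_on_local:
  assumes "\<And>x. x \<in> S \<Longrightarrow> \<exists>T. open T \<and> x \<in> T \<and> smooth_on T f"
  shows "smooth_on S f"
  unfolding smooth_on_def
proof
  fix k
  show "Ck_on k S f"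
    by (rule Ck_on_local) (use assms in \<open>auto simp: smooth_on_def\<close>)
qed

lemma smooth_on_compose:
  fixes f :: "'a::euclidean_space \<Rightarrow> 'b::euclidean_space" and g :: "'b \<Rightarrow> 'c::real_normed_vector"
  assumes "open S" "open T" "f ` S \<subseteq> T" "smooth_on S f" "smooth_on T g"
  shows "smooth_on S (\<lambda>x. g (f x))"
  unfolding smooth_on_def
proof
  fix k
  show "Ck_on k S (\<lambda>x. g (f x))"
    using assms(4,5) unfolding smooth_on_def by (blast intro: Ck_on_compose[OF assms(1-3), of k g])
qed

lemma smooth_on_has_derivative:
  assumes "smooth_on S f" "x \<in> S"
  shows "(f has_derivative frechet_derivative f (at x)) (at x)"
proof -
  have "Ck_on (Suc 0) S f"
    using assms(1) unfolding smooth_on_def by blast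
  from Ck_on_SucE[OF this assms(2)] show ?thesis .
qed

lemma smooth_on_frechet_derivative:
  assumes "smooth_on S f" "b \<in> Basis"
  shows "smooth_on S (\<lambda>x. frechet_derivative f (at x) b)"
  unfolding smooth_on_def
proof
  fix k
  have "Ck_on (Suc k) S f"
    using assms(1) unfolding smooth_on_def by blast
  then show "Ck_on k S (\<lambda>x. frechet_derivative f (at x) b)"
    using assms(2) by simp
qed

section \<open>Charts and smooth functions\<close>

lemma is_chart_inv:
  assumes "is_chart (U, \<phi>)" "p \<in> U"
  shows "inv_into U \<phi> (\<phi> p) = p"
  using assms by (auto simp: is_chart_def homeomorphism_def)

lemma is_chart_open_image:
  assumes "is_chart (U, \<phi>)" "open W"
  shows "open (\<phi> ` (U \<inter> W))"
proof -
  have *: "open U" "open (\<phi> ` U)" "homeomorphism U (\<phi> ` U) \<phi> (inv_into U \<phi>)"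
    using assms(1) by (auto simp: is_chart_def)
  have "openin (top_of_set (\<phi> ` U)) (\<phi> ` (U \<inter> W))"
    using assms(2) by (intro homeomorphism_imp_open_map[OF *(3)]) auto
  then show ?thesis
    using *(2) openin_open_trans by blast
qed

lemma is_chart_open_vimage:
  assumes "is_chart (U, \<phi>)" "open B"
  shows "open (U \<inter> \<phi> -` B)"
  using assms by (auto simp: is_chart_def homeomorphism_def intro: continuous_open_preimage)

locale smooth_manifold =
  fixes A :: "('p::{t2_space,second_countable_topology}, 'e::euclidean_space) chart set"
  assumes atlas: "smooth_atlas A"
begin

lemma charts: "(U, \<phi>) \<in> A \<Longrightarrow> is_chart (U, \<phi>)"
  using atlas unfolding smooth_atlas_def by blast

lemma chart_around: obtains U \<phi> where "(U, \<phi>) \<in> A" "p \<in> U"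
  using atlas unfolding smooth_atlas_def by blast

lemma transition_smooth:
  "(U, \<phi>) \<in> A \<Longrightarrow> (V, \<psi>) \<in> A \<Longrightarrow> smooth_on (\<phi> ` (U \<inter> V)) (\<psi> \<circ> inv_into U \<phi>)"
  using atlas unfolding smooth_atlas_def by blast

lemma smooth_funI:
  "(\<And>U \<phi>. (U, \<phi>) \<in> A \<Longrightarrow> smooth_on (\<phi> ` (U \<inter> W)) (f \<circ> inv_into U \<phi>)) \<Longrightarrow> smooth_fun A W f"
  by (auto simp: smooth_fun_def)

lemma smooth_funD:
  "smooth_fun A W f \<Longrightarrow> (U, \<phi>) \<in> A \<Longrightarrow> smooth_on (\<phi> ` (U \<inter> W)) (f \<circ> inv_into U \<phi>)"
  by (auto simp: smooth_fun_def)

lemma smooth_fun_cong: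
  assumes "open W" "\<And>p. p \<in> W \<Longrightarrow> f p = g p" "smooth_fun A W f"
  shows "smooth_fun A W g"
proof (rule smooth_funI)
  fix U \<phi> assume c: "(U, \<phi>) \<in> A"
  show "smooth_on (\<phi> ` (U \<inter> W)) (g \<circ> inv_into U \<phi>)"
    by (rule smooth_on_cong[OF is_chart_open_image[OF charts[OF c] assms(1)] _ smooth_funD[OF assms(3) c]])
      (use assms(2) is_chart_inv[OF charts[OF c]] in auto)
qed

lemma smooth_fun_subset: "smooth_fun A W f \<Longrightarrow> V \<subseteq> W \<Longrightarrow> smooth_fun A V f"
  unfolding smooth_fun_def by (fast intro: smooth_on_subset)

lemma smooth_fun_local:
  assumes "\<And>p. p \<in> W \<Longrightarrow> \<exists>V. open V \<and> p \<in> V \<and> smooth_fun A V f"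
  shows "smooth_fun A W f"
proof (intro smooth_funI smooth_on_local)
  fix U \<phi> x assume c: "(U, \<phi>) \<in> A" and "x \<in> \<phi> ` (U \<inter> W)"
  then obtain p where p: "p \<in> U" "p \<in> W" "x = \<phi> p" by auto
  then obtain V where "open V" "p \<in> V" "smooth_fun A V f" using assms by blast
  with p show "\<exists>T. open T \<and> x \<in> T \<and> smooth_on T (f \<circ> inv_into U \<phi>)"
    using is_chart_open_image[OF charts[OF c]] smooth_funD[OF _ c] by blast
qed

lemma smooth_fun_const: "smooth_fun A W (\<lambda>_. c)"
  using Ck_on_const by (auto intro!: smooth_funI simp: smooth_on_def o_def)

lemma smooth_fun_add:
  assumes "open W" "smooth_fun A W f" "smooth_fun A W g"
  shows "smooth_fun A W (\<lambda>p. f p + g p)"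
proof (rule smooth_funI)
  fix U \<phi> assume c: "(U, \<phi>) \<in> A"
  show "smooth_on (\<phi> ` (U \<inter> W)) ((\<lambda>p. f p + g p) \<circ> inv_into U \<phi>)"
    using smooth_funD[OF assms(2) c] smooth_funD[OF assms(3) c]
    by (auto simp: smooth_on_def o_def intro!: Ck_on_add[OF is_chart_open_image[OF charts[OF c] assms(1)]])
qed

lemma smooth_fun_mult:
  assumes "open W" "smooth_fun A W f" "smooth_fun A W g"
  shows "smooth_fun A W (\<lambda>p. f p * g p)"
proof (rule smooth_funI)
  fix U \<phi> assume c: "(U, \<phi>) \<in> A"
  show "smooth_on (\<phi> ` (U \<inter> W)) ((\<lambda>p. f p * g p) \<circ> inv_into U \<phi>)"
    using smooth_funD[OF assms(2) c] smooth_funD[OF assms(3) c]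
    by (auto simp: smooth_on_def o_def intro!: Ck_on_bounded_bilinear[OF
          is_chart_open_image[OF charts[OF c] assms(1)] bounded_bilinear_mult])
qed

lemma smooth_fun_minus:
  assumes "open W" "smooth_fun A W f"
  shows "smooth_fun A W (\<lambda>p. - f p)"
  using smooth_fun_mult[OF assms(1) smooth_fun_const assms(2), of "-1"] by simp

lemma smooth_fun_diff:
  assumes "open W" "smooth_fun A W f" "smooth_fun A W g"
  shows "smooth_fun A W (\<lambda>p. f p - g p)"
  using smooth_fun_add[OF assms(1,2) smooth_fun_minus[OF assms(1,3)]] by simp

lemma smooth_fun_divide:
  assumes "open W" "smooth_fun A W f" "smooth_fun A W g" "\<And>p. p \<in> W \<Longrightarrow> g p \<noteq> 0"
  shows "smooth_fun A W (\<lambda>p. f p / g p)"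
proof -
  have "smooth_fun A W (\<lambda>p. inverse (g p))"
  proof (rule smooth_funI)
    fix U \<phi> assume c: "(U, \<phi>) \<in> A"
    show "smooth_on (\<phi> ` (U \<inter> W)) ((\<lambda>p. inverse (g p)) \<circ> inv_into U \<phi>)"
      using smooth_funD[OF assms(3) c] assms(4)
      by (auto simp: smooth_on_def o_def is_chart_inv[OF charts[OF c]]
          intro!: Ck_on_inverse[OF is_chart_open_image[OF charts[OF c] assms(1)]])
  qed
  from smooth_fun_mult[OF assms(1,2) this] show ?thesis
    by (simp add: divide_inverse)
qed

section \<open>Functions smooth near a point\<close>

lemma smooth_atI: "open W \<Longrightarrow> p \<in> W \<Longrightarrow> smooth_fun A W f \<Longrightarrow> smooth_at A p f"
  by (auto simp: smooth_at_def)

lemma smooth_at_common: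
  assumes "smooth_at A p f" "smooth_at A p g"
  obtains W where "open W" "p \<in> W" "smooth_fun A W f" "smooth_fun A W g"
proof -
  obtain V W where "open V" "p \<in> V" "smooth_fun A V f" "open W" "p \<in> W" "smooth_fun A W g"
    using assms by (auto simp: smooth_at_def)
  then show thesis
    using that[of "V \<inter> W"] smooth_fun_subset by auto
qed

lemma smooth_at_const: "smooth_at A p (\<lambda>_. c)"
  by (rule smooth_atI[of UNIV]) (auto intro: smooth_fun_const)

lemma smooth_at_add: "smooth_at A p f \<Longrightarrow> smooth_at A p g \<Longrightarrow> smooth_at A p (\<lambda>q. f q + g q)"
  by (erule (1) smooth_at_common) (auto intro: smooth_atI smooth_fun_add)

lemma smooth_at_mult: "smooth_at A p f \<Longrightarrow> smooth_at A p g \<Longrightarrow> smooth_at A p (\<lambda>q. f q * g q)"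
  by (erule (1) smooth_at_common) (auto intro: smooth_atI smooth_fun_mult)

lemma smooth_at_diff: "smooth_at A p f \<Longrightarrow> smooth_at A p g \<Longrightarrow> smooth_at A p (\<lambda>q. f q - g q)"
  by (erule (1) smooth_at_common) (auto intro: smooth_atI smooth_fun_diff)

lemma smooth_at_sum:
  "(\<And>i. i \<in> J \<Longrightarrow> smooth_at A p (f i)) \<Longrightarrow> smooth_at A p (\<lambda>q. \<Sum>i\<in>J. f i q)"
  by (induction J rule: infinite_finite_induct) (auto intro: smooth_at_const smooth_at_add)

lemma smooth_at_cong:
  assumes "smooth_at A p f" "\<forall>\<^sub>F q in nhds p. f q = g q"
  shows "smooth_at A p g"
proof -
  obtain W where W: "open W" "p \<in> W" "smooth_fun A W f"
    using assms(1) by (auto simp: smooth_at_def)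
  obtain V where V: "open V" "p \<in> V" "\<forall>q\<in>V. f q = g q"
    using assms(2) unfolding eventually_nhds by blast
  have "smooth_fun A (W \<inter> V) g"
    by (rule smooth_fun_cong[of _ f]) (use W V smooth_fun_subset in auto)
  with W V show ?thesis by (auto intro: smooth_atI[of "W \<inter> V"])
qed

section \<open>Tangent vectors and vector fields\<close>

lemma tangent_not_smooth: "v \<in> tangent_space A p \<Longrightarrow> \<not> smooth_at A p f \<Longrightarrow> v f = 0"
  unfolding tangent_space_def by blast

text \<open>Smoothness near \<open>p\<close> depends only on the germ, so two functions with the
  same germ that are not smooth are both sent to 0. Locality thus carries no smoothness
  condition.\<close>

lemma tangent_cong:
  assumes "v \<in> tangent_space A p" "\<forall>\<^sub>F q in nhds p. f q = g q"
  shows "v f = v g"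
proof (cases "smooth_at A p f")
  case True
  then have "smooth_at A p g" using smooth_at_cong assms(2) by blast
  with True show ?thesis using assms unfolding tangent_space_def by blast
next
  case False
  moreover have "\<not> smooth_at A p g"
    using False smooth_at_cong[of p g f] assms(2) by (auto simp: eq_commute)
  ultimately show ?thesis using tangent_not_smooth[OF assms(1)] by simp
qed

lemma tangent_lincomb:
  assumes "v \<in> tangent_space A p" "smooth_at A p f" "smooth_at A p g"
  shows "v (\<lambda>q. a * f q + b * g q) = a * v f + b * v g"
  using assms unfolding tangent_space_def by blast

lemma tangent_mult:
  assumes "v \<in> tangent_space A p" "smooth_at A p f" "smooth_at A p g"
  shows "v (\<lambda>q. f q * g q) = f p * v g + g p * v f"
  using assms unfolding tangent_space_def by blast

lemma tangent_add:
  assumes "v \<in> tangent_space A p" "smooth_at A p f" "smooth_at A p g"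
  shows "v (\<lambda>q. f q + g q) = v f + v g"
  using tangent_lincomb[OF assms, of 1 1] by simp

lemma tangent_diff:
  assumes "v \<in> tangent_space A p" "smooth_at A p f" "smooth_at A p g"
  shows "v (\<lambda>q. f q - g q) = v f - v g"
  using tangent_lincomb[OF assms, of 1 "-1"] by simp

lemma tangent_const:
  assumes "v \<in> tangent_space A p"
  shows "v (\<lambda>_. c) = 0"
proof -
  \<comment> \<open>The product rule for 1 = 1 * 1 reads v(1) = 2 v(1).\<close>
  have "v (\<lambda>_. 1) = 0"
    using tangent_mult[OF assms smooth_at_const smooth_at_const, of 1 1] by simp
  then show ?thesis
    using tangent_lincomb[OF assms smooth_at_const smooth_at_const, of c 1 0 1] by simp
qed

lemma tangent_zero_near: "v \<in> tangent_space A p \<Longrightarrow> \<forall>\<^sub>F q in nhds p. f q = 0 \<Longrightarrow> v f = 0"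
  using tangent_cong[of v p f "\<lambda>_. 0"] tangent_const by simp

lemma tangent_sum:
  assumes "v \<in> tangent_space A p" "\<And>i. i \<in> J \<Longrightarrow> smooth_at A p (f i)"
  shows "v (\<lambda>q. \<Sum>i\<in>J. f i q) = (\<Sum>i\<in>J. v (f i))"
  using assms(2) by (induction J rule: infinite_finite_induct)
    (auto simp: tangent_const[OF assms(1)] tangent_add[OF assms(1)] smooth_at_sum)

section \<open>Linear structure of the tangent spaces, and smooth vector fields\<close>

lemma tangent_space_zero: "0 \<in> tangent_space A p"
  by (auto simp: tangent_space_def)

lemma tangent_space_add:
  assumes "u \<in> tangent_space A p" "v \<in> tangent_space A p"
  shows "u + v \<in> tangent_space A p"
  unfolding tangent_space_def
proof (intro CollectI conjI allI impI)
  fix f g :: "'p \<Rightarrow> real" and a b :: real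
  show "(u + v) f = 0" if "\<not> smooth_at A p f"
    using assms that by (simp add: tangent_not_smooth)
  show "(u + v) f = (u + v) g" if "\<forall>\<^sub>F q in nhds p. f q = g q"
    using tangent_cong[OF assms(1) that] tangent_cong[OF assms(2) that] by simp
  assume fg: "smooth_at A p f" "smooth_at A p g"
  show "(u + v) (\<lambda>q. a * f q + b * g q) = a * (u + v) f + b * (u + v) g"
    using tangent_lincomb[OF assms(1) fg] tangent_lincomb[OF assms(2) fg] by (simp add: algebra_simps)
  show "(u + v) (\<lambda>q. f q * g q) = f p * (u + v) g + g p * (u + v) f"
    using tangent_mult[OF assms(1) fg] tangent_mult[OF assms(2) fg] by (simp add: algebra_simps)
qed

lemma tangent_space_scale:
  assumes "v \<in> tangent_space A p"
  shows "c *\<^sub>T v \<in> tangent_space A p"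
  unfolding tangent_space_def tscale_def
proof (intro CollectI conjI allI impI)
  fix f g :: "'p \<Rightarrow> real" and a b :: real
  show "c * v f = 0" if "\<not> smooth_at A p f"
    using assms that by (simp add: tangent_not_smooth)
  show "c * v f = c * v g" if "\<forall>\<^sub>F q in nhds p. f q = g q"
    using tangent_cong[OF assms that] by simp
  assume fg: "smooth_at A p f" "smooth_at A p g"
  show "c * v (\<lambda>q. a * f q + b * g q) = a * (c * v f) + b * (c * v g)"
    using tangent_lincomb[OF assms fg] by (simp add: algebra_simps)
  show "c * v (\<lambda>q. f q * g q) = f p * (c * v g) + g p * (c * v f)"
    using tangent_mult[OF assms fg] by (simp add: algebra_simps)
qed

lemma tangent_space_sum:
  "(\<And>i. i \<in> J \<Longrightarrow> v i \<in> tangent_space A p) \<Longrightarrow> (\<Sum>i\<in>J. v i) \<in> tangent_space A p"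
  by (induction J rule: infinite_finite_induct) (auto simp: tangent_space_zero tangent_space_add)

lemma tangent_space_diff:
  assumes "u \<in> tangent_space A p" "v \<in> tangent_space A p"
  shows "u - v \<in> tangent_space A p"
proof -
  have "u - v = u + (-1) *\<^sub>T v"
    by (simp add: fun_eq_iff tscale_def)
  then show ?thesis
    using tangent_space_add[OF assms(1) tangent_space_scale[OF assms(2)]] by (simp only:)
qed

lemma vfields_tangent: "X \<in> vfields A U \<Longrightarrow> p \<in> U \<Longrightarrow> X p \<in> tangent_space A p"
  by (auto simp: vfields_def)

lemma vfields_smooth:
  "X \<in> vfields A U \<Longrightarrow> open W \<Longrightarrow> W \<subseteq> U \<Longrightarrow> smooth_fun A W f \<Longrightarrow> smooth_fun A W (\<lambda>p. X p f)"
  by (auto simp: vfields_def)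

lemma vfieldsI:
  assumes "\<And>p. p \<in> U \<Longrightarrow> X p \<in> tangent_space A p"
    and "\<And>W f. open W \<Longrightarrow> W \<subseteq> U \<Longrightarrow> smooth_fun A W f \<Longrightarrow> smooth_fun A W (\<lambda>p. X p f)"
  shows "X \<in> vfields A U"
  unfolding vfields_def mem_Collect_eq
proof (intro conjI ballI allI impI)
  show "X p \<in> tangent_space A p" if "p \<in> U" for p
    using that by (rule assms(1))
  show "smooth_fun A W (\<lambda>p. X p f)" if "open W" "W \<subseteq> U" "smooth_fun A W f" for W f
    using that by (rule assms(2))
qed

lemma vfields_smooth_at:
  assumes "X \<in> vfields A U" "open U" "p \<in> U" "smooth_at A p f"
  shows "smooth_at A p (\<lambda>q. X q f)"
proof -
  obtain W where W: "open W" "p \<in> W" "smooth_fun A W f"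
    using assms(4) by (auto simp: smooth_at_def)
  then have "smooth_fun A (W \<inter> U) (\<lambda>q. X q f)"
    using assms smooth_fun_subset[OF W(3), of "W \<inter> U"] by (intro vfields_smooth[OF assms(1)]) auto
  with W assms show ?thesis by (auto intro: smooth_atI[of "W \<inter> U"])
qed

lemma vfields_cong:
  assumes "X \<in> vfields A U" "\<And>p. p \<in> U \<Longrightarrow> X p = Y p"
  shows "Y \<in> vfields A U"
proof (rule vfieldsI)
  show "Y p \<in> tangent_space A p" if "p \<in> U" for p
    using vfields_tangent[OF assms(1) that] assms(2)[OF that] by simp
  fix W f assume W: "open W" "W \<subseteq> U" "smooth_fun A W f"
  show "smooth_fun A W (\<lambda>p. Y p f)"
    by (rule smooth_fun_cong[OF W(1) _ vfields_smooth[OF assms(1) W]]) (use assms(2) W in auto)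
qed

lemma vfields_subset:
  assumes "X \<in> vfields A U" "V \<subseteq> U"
  shows "X \<in> vfields A V"
proof (rule vfieldsI)
  show "X p \<in> tangent_space A p" if "p \<in> V" for p
    using vfields_tangent[OF assms(1)] assms(2) that by auto
  show "smooth_fun A W (\<lambda>p. X p f)" if "open W" "W \<subseteq> V" "smooth_fun A W f" for W f
    using vfields_smooth[OF assms(1) that(1) _ that(3)] assms(2) that(2) by simp
qed

lemma vfields_local:
  assumes "\<And>p. p \<in> U \<Longrightarrow> \<exists>V. open V \<and> p \<in> V \<and> X \<in> vfields A V"
  shows "X \<in> vfields A U"
proof (rule vfieldsI)
  show "X p \<in> tangent_space A p" if "p \<in> U" for p
    using assms[OF that] vfields_tangent by blast
  fix W f assume W: "open W" "W \<subseteq> U" "smooth_fun A W f"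
  show "smooth_fun A W (\<lambda>p. X p f)"
  proof (rule smooth_fun_local)
    fix p assume p: "p \<in> W"
    then obtain V where V: "open V" "p \<in> V" "X \<in> vfields A V"
      using assms W by blast
    have "smooth_fun A (V \<inter> W) (\<lambda>p. X p f)"
      using V W by (intro vfields_smooth[OF V(3)] smooth_fun_subset[OF W(3)]) auto
    then show "\<exists>V. open V \<and> p \<in> V \<and> smooth_fun A V (\<lambda>p. X p f)"
      using V W p by blast
  qed
qed

lemma vfields_add:
  assumes "open U" "X \<in> vfields A U" "Y \<in> vfields A U"
  shows "X + Y \<in> vfields A U"
  using assms by (auto intro!: vfieldsI tangent_space_add smooth_fun_add
      dest: vfields_tangent vfields_smooth)

lemma vfields_fscale:
  assumes "open U" "X \<in> vfields A U" "smooth_fun A U f"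
  shows "fscale f X \<in> vfields A U"
proof (rule vfieldsI)
  show "fscale f X p \<in> tangent_space A p" if "p \<in> U" for p
    using tangent_space_scale[OF vfields_tangent[OF assms(2) that]] by (simp add: fscale_def)
  fix W h assume W: "open W" "W \<subseteq> U" "smooth_fun A W h"
  show "smooth_fun A W (\<lambda>p. fscale f X p h)"
    using smooth_fun_mult[OF W(1) smooth_fun_subset[OF assms(3) W(2)] vfields_smooth[OF assms(2) W]]
    by (simp add: fscale_def tscale_def)
qed

lemma vfields_zero: "0 \<in> vfields A U"
  using tangent_space_zero smooth_fun_const by (auto intro!: vfieldsI)

lemma vfields_sum:
  assumes "open U" "\<And>i. i \<in> J \<Longrightarrow> X i \<in> vfields A U"
  shows "(\<Sum>i\<in>J. X i) \<in> vfields A U"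
  using assms(2)
proof (induction J rule: infinite_finite_induct)
  case (insert i J)
  then have "X i + (\<Sum>i\<in>J. X i) \<in> vfields A U"
    by (intro vfields_add[OF assms(1)]) auto
  then show ?case
    unfolding sum.insert[OF insert.hyps] .
qed (simp_all add: vfields_zero)

section \<open>The Lie bracket\<close>

lemma lie_bracket_apply:
  "smooth_at A p f \<Longrightarrow> lie_bracket A X Y p f = X p (\<lambda>q. Y q f) - Y p (\<lambda>q. X q f)"
  by (simp add: lie_bracket_def)

text \<open>A composition of two fields fails the product rule by the cross terms (Z' g)(Z f) + (Z'
  f)(Z g). They are symmetric in the two fields and cancel in the commutator.\<close>

lemma lie_bracket_tangent:
  assumes U: "open U" "p \<in> U" and X: "X \<in> vfields A U" and Y: "Y \<in> vfields A U"
  shows "lie_bracket A X Y p \<in> tangent_space A p"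
proof -
  note T = vfields_tangent[OF X] vfields_tangent[OF Y]
  note S = vfields_smooth_at[OF X U(1)] vfields_smooth_at[OF Y U(1)]
  \<comment> \<open>The inner field is evaluated at neighbouring points, so the rules for it are
    needed on a neighbourhood and are then transported through the outer derivation as an equality
    of germs.\<close>
  have near: "\<forall>\<^sub>F q in nhds p. q \<in> U \<and> smooth_at A q f \<and> smooth_at A q g"
    if f: "smooth_at A p f" and g: "smooth_at A p g" for f g
  proof -
    obtain W where W: "open W" "p \<in> W" "smooth_fun A W f" "smooth_fun A W g"
      using smooth_at_common[OF f g] .
    then show ?thesis
      unfolding eventually_nhds using U smooth_atI by (intro exI[of _ "W \<inter> U"]) auto
  qed
  have lin: "Z p (\<lambda>q. Z' q (\<lambda>q. a * f q + b * g q)) = a * Z p (\<lambda>q. Z' q f) + b * Z p (\<lambda>q. Z' q g)"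
    if Z: "Z \<in> vfields A U" "Z' \<in> vfields A U" and f: "smooth_at A p f" and g: "smooth_at A p g"
    for Z Z' f g a b
  proof -
    have "Z p (\<lambda>q. Z' q (\<lambda>q. a * f q + b * g q)) = Z p (\<lambda>q. a * Z' q f + b * Z' q g)"
      by (rule tangent_cong[OF vfields_tangent[OF Z(1) U(2)] eventually_mono[OF near[OF f g]]])
        (auto intro!: tangent_lincomb vfields_tangent[OF Z(2)])
    then show ?thesis
      using tangent_lincomb[OF vfields_tangent[OF Z(1) U(2)] vfields_smooth_at[OF Z(2) U f]
          vfields_smooth_at[OF Z(2) U g]] by simp
  qed
  have prod: "Z p (\<lambda>q. Z' q (\<lambda>q. f q * g q)) = f p * Z p (\<lambda>q. Z' q g) + Z' p g * Z p f
       + (g p * Z p (\<lambda>q. Z' q f) + Z' p f * Z p g)"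
    if Z: "Z \<in> vfields A U" "Z' \<in> vfields A U" and f: "smooth_at A p f" and g: "smooth_at A p g"
    for Z Z' f g
  proof -
    note ZT = vfields_tangent[OF Z(1) U(2)]
    note sm = vfields_smooth_at[OF Z(2) U f] vfields_smooth_at[OF Z(2) U g] f g
    have "Z p (\<lambda>q. Z' q (\<lambda>q. f q * g q)) = Z p (\<lambda>q. f q * Z' q g + g q * Z' q f)"
      by (rule tangent_cong[OF ZT eventually_mono[OF near[OF f g]]])
        (auto intro!: tangent_mult vfields_tangent[OF Z(2)])
    then show ?thesis
      by (simp add: tangent_add[OF ZT] tangent_mult[OF ZT] smooth_at_mult sm)
  qed
  show ?thesis
    unfolding tangent_space_def
  proof (intro CollectI conjI allI impI)
    fix f g :: "'p \<Rightarrow> real" and a b :: real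
    show "lie_bracket A X Y p f = 0" if "\<not> smooth_at A p f"
      using that by (simp add: lie_bracket_def)
    assume f: "smooth_at A p f" and g: "smooth_at A p g"
    show "lie_bracket A X Y p (\<lambda>q. a * f q + b * g q)
        = a * lie_bracket A X Y p f + b * lie_bracket A X Y p g"
      using f g by (simp add: lie_bracket_apply smooth_at_add smooth_at_mult smooth_at_const lin X Y
          algebra_simps)
    show "lie_bracket A X Y p (\<lambda>q. f q * g q) = f p * lie_bracket A X Y p g + g p * lie_bracket A X Y p f"
      using f g by (simp add: lie_bracket_apply smooth_at_mult prod X Y algebra_simps)
    assume "\<forall>\<^sub>F q in nhds p. f q = g q"
    then obtain V where V: "open V" "p \<in> V" "\<And>q. q \<in> V \<Longrightarrow> f q = g q"
      unfolding eventually_nhds by blast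
    have eq: "Z p (\<lambda>q. Z' q f) = Z p (\<lambda>q. Z' q g)" if Z: "Z \<in> vfields A U" "Z' \<in> vfields A U" for Z Z'
    proof (rule tangent_cong[OF vfields_tangent[OF Z(1) U(2)]])
      have "Z' q f = Z' q g" if "q \<in> U \<inter> V" for q
        by (rule tangent_cong[OF vfields_tangent[OF Z(2)]])
          (use that V in \<open>auto simp: eventually_nhds\<close>)
      then show "\<forall>\<^sub>F q in nhds p. Z' q f = Z' q g"
        unfolding eventually_nhds using U V by (intro exI[of _ "U \<inter> V"]) auto
    qed
    show "lie_bracket A X Y p f = lie_bracket A X Y p g"
      using f g by (simp add: lie_bracket_apply eq[OF X Y] eq[OF Y X])
  qed
qed

lemma lie_bracket_vfields:
  assumes "open U" "X \<in> vfields A U" "Y \<in> vfields A U"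
  shows "lie_bracket A X Y \<in> vfields A U"
proof (rule vfieldsI)
  show "lie_bracket A X Y p \<in> tangent_space A p" if "p \<in> U" for p
    using lie_bracket_tangent[OF assms(1) that assms(2,3)] .
  fix W f assume W: "open W" "W \<subseteq> U" "smooth_fun A W f"
  have "smooth_fun A W (\<lambda>p. X p (\<lambda>q. Y q f) - Y p (\<lambda>q. X q f))"
    by (intro smooth_fun_diff vfields_smooth[OF assms(2)] vfields_smooth[OF assms(3)] W)
  then show "smooth_fun A W (\<lambda>p. lie_bracket A X Y p f)"
    by (rule smooth_fun_cong[OF W(1), rotated]) (use smooth_atI[OF W(1) _ W(3)] in \<open>auto simp: lie_bracket_apply\<close>)
qed

lemma lie_bracket_antisym: "lie_bracket A Y X p = - lie_bracket A X Y p"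
  by (simp add: lie_bracket_def fun_eq_iff)

lemma lie_bracket_add_right:
  assumes "open U" "p \<in> U" "X \<in> vfields A U" "Y \<in> vfields A U" "Z \<in> vfields A U"
  shows "lie_bracket A X (Y + Z) p = lie_bracket A X Y p + lie_bracket A X Z p"
proof
  fix f
  show "lie_bracket A X (Y + Z) p f = (lie_bracket A X Y p + lie_bracket A X Z p) f"
    using tangent_add[OF vfields_tangent[OF assms(3,2)] vfields_smooth_at[OF assms(4,1,2)]
        vfields_smooth_at[OF assms(5,1,2)], of f f]
    by (simp add: lie_bracket_def)
qed

lemma lie_bracket_fscale_right:
  assumes "open U" "p \<in> U" "X \<in> vfields A U" "Y \<in> vfields A U" "smooth_fun A U f"
  shows "lie_bracket A X (fscale f Y) p = X p f *\<^sub>T Y p + f p *\<^sub>T lie_bracket A X Y p"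
proof
  fix h
  have f: "smooth_at A p f" using assms smooth_atI by blast
  show "lie_bracket A X (fscale f Y) p h = (X p f *\<^sub>T Y p + f p *\<^sub>T lie_bracket A X Y p) h"
    using tangent_mult[OF vfields_tangent[OF assms(3,2)] f vfields_smooth_at[OF assms(4,1,2)], of h]
      tangent_not_smooth[OF vfields_tangent[OF assms(4,2)], of h]
    by (auto simp: lie_bracket_def fscale_def tscale_def algebra_simps)
qed

lemma lie_bracket_cong_right:
  assumes "open U" "p \<in> U" "X p \<in> tangent_space A p" "\<And>q. q \<in> U \<Longrightarrow> Y q = Z q"
  shows "lie_bracket A X Y p = lie_bracket A X Z p"
proof
  fix f
  have "X p (\<lambda>q. Y q f) = X p (\<lambda>q. Z q f)"
    by (rule tangent_cong[OF assms(3)]) (use assms in \<open>auto simp: eventually_nhds\<close>)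
  then show "lie_bracket A X Y p f = lie_bracket A X Z p f"
    using assms by (simp add: lie_bracket_def)
qed

end

lemma sum_fun_apply: "(\<Sum>i\<in>J. f i) x = (\<Sum>i\<in>J. f i x)"
  by (induction J rule: infinite_finite_induct) auto

section \<open>Coordinate vector fields\<close>

text \<open>The chart need not be a member of \<open>A\<close>: foliated charts come from a
  different atlas and still have to serve for the smooth structure of \<open>A\<close>.\<close>

locale compatible_chart = smooth_manifold A
  for A :: "('p::{t2_space,second_countable_topology}, 'e::euclidean_space) chart set" +
  fixes U :: "'p set" and \<phi> :: "'p \<Rightarrow> 'e"
  assumes compatible: "smooth_atlas (insert (U, \<phi>) A)"
begin

lemma chart: "is_chart (U, \<phi>)"
  using smooth_manifold.charts[of "insert (U, \<phi>) A"] compatible by (simp add: smooth_manifold_def)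

lemma open_dom: "open U"
  using chart by (simp add: is_chart_def)

lemma chart_inv: "p \<in> U \<Longrightarrow> inv_into U \<phi> (\<phi> p) = p"
  using is_chart_inv[OF chart] .

lemma open_image: "open W \<Longrightarrow> W \<subseteq> U \<Longrightarrow> open (\<phi> ` W)"
  using is_chart_open_image[OF chart, of W] by (simp add: Int_absorb1)

lemma transition_to: "(V, \<psi>) \<in> A \<Longrightarrow> smooth_on (\<phi> ` (U \<inter> V)) (\<psi> \<circ> inv_into U \<phi>)"
  using smooth_manifold.transition_smooth[of "insert (U, \<phi>) A"] compatible
  by (simp add: smooth_manifold_def)

lemma transition_from: "(V, \<psi>) \<in> A \<Longrightarrow> smooth_on (\<psi> ` (V \<inter> U)) (\<phi> \<circ> inv_into V \<psi>)"
  using smooth_manifold.transition_smooth[of "insert (U, \<phi>) A"] compatible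
  by (simp add: smooth_manifold_def)

text \<open>Transition maps in both directions translate between this chart and those of
  \<open>A\<close>. The forward direction is local, since \<open>W\<close> may meet several domains
  of \<open>A\<close>.\<close>

lemma smooth_fun_iff:
  assumes W: "open W" "W \<subseteq> U"
  shows "smooth_fun A W f \<longleftrightarrow> smooth_on (\<phi> ` W) (f \<circ> inv_into U \<phi>)"
proof
  assume f: "smooth_fun A W f"
  show "smooth_on (\<phi> ` W) (f \<circ> inv_into U \<phi>)"
  proof (rule smooth_on_local)
    fix x assume "x \<in> \<phi> ` W"
    then obtain p where p: "p \<in> W" "x = \<phi> p" by auto
    obtain V \<psi> where V: "(V, \<psi>) \<in> A" "p \<in> V" by (rule chart_around)
    have oV: "open V" using charts[OF V(1)] by (simp add: is_chart_def)
    let ?T = "\<phi> ` (W \<inter> V)"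
    have T: "open ?T" using oV W by (intro open_image) auto
    have "smooth_on ?T (\<lambda>x. (f \<circ> inv_into V \<psi>) ((\<psi> \<circ> inv_into U \<phi>) x))"
    proof (rule smooth_on_compose[OF T is_chart_open_image[OF charts[OF V(1)] W(1)]])
      show "(\<psi> \<circ> inv_into U \<phi>) ` ?T \<subseteq> \<psi> ` (V \<inter> W)"
        using W by (auto simp: chart_inv subset_iff)
      show "smooth_on ?T (\<psi> \<circ> inv_into U \<phi>)"
        using W by (intro smooth_on_subset[OF transition_to[OF V(1)]]) auto
      show "smooth_on (\<psi> ` (V \<inter> W)) (f \<circ> inv_into V \<psi>)"
        by (rule smooth_funD[OF f V(1)])
    qed
    then have "smooth_on ?T (f \<circ> inv_into U \<phi>)"
      by (rule smooth_on_cong[OF T, rotated])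
        (use W in \<open>auto simp: chart_inv subset_iff is_chart_inv[OF charts[OF V(1)]]\<close>)
    then show "\<exists>T. open T \<and> x \<in> T \<and> smooth_on T (f \<circ> inv_into U \<phi>)"
      using T p V by blast
  qed
next
  assume f: "smooth_on (\<phi> ` W) (f \<circ> inv_into U \<phi>)"
  show "smooth_fun A W f"
  proof (rule smooth_funI)
    fix V \<psi> assume V: "(V, \<psi>) \<in> A"
    let ?T = "\<psi> ` (V \<inter> W)"
    have T: "open ?T" using is_chart_open_image[OF charts[OF V] W(1)] .
    have "smooth_on ?T (\<lambda>x. (f \<circ> inv_into U \<phi>) ((\<phi> \<circ> inv_into V \<psi>) x))"
    proof (rule smooth_on_compose[OF T open_image[OF W] _ _ f])
      show "(\<phi> \<circ> inv_into V \<psi>) ` ?T \<subseteq> \<phi> ` W"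
        by (auto simp: is_chart_inv[OF charts[OF V]])
      show "smooth_on ?T (\<phi> \<circ> inv_into V \<psi>)"
        using W by (intro smooth_on_subset[OF transition_from[OF V]]) auto
    qed
    then show "smooth_on ?T (f \<circ> inv_into V \<psi>)"
      by (rule smooth_on_cong[OF T, rotated])
        (use W in \<open>auto simp: chart_inv subset_iff is_chart_inv[OF charts[OF V]]\<close>)
  qed
qed

definition coord :: "'e \<Rightarrow> 'p \<Rightarrow> real" where
  "coord b = (\<lambda>q. \<phi> q \<bullet> b)"

text \<open>The partial derivative in direction \<open>b\<close>; the default 0 is the normalisation
  built into \<open>tangent_space\<close>.\<close>

definition coord_vf :: "'e \<Rightarrow> 'p vfield" where
  "coord_vf b = (\<lambda>p f. if smooth_at A p f then frechet_derivative (f \<circ> inv_into U \<phi>) (at (\<phi> p)) b else 0)"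

lemma smooth_fun_comp_chart:
  assumes "open W" "W \<subseteq> U" "smooth_on (\<phi> ` W) F"
  shows "smooth_fun A W (\<lambda>q. F (\<phi> q))"
  unfolding smooth_fun_iff[OF assms(1,2)]
  by (rule smooth_on_cong[OF open_image[OF assms(1,2)] _ assms(3)])
    (use assms(2) in \<open>auto simp: chart_inv subset_iff\<close>)

lemma coord_smooth: "smooth_fun A U (coord b)"
proof -
  have "smooth_on (\<phi> ` U) (\<lambda>x. x \<bullet> b)"
    using open_image[OF open_dom] unfolding smooth_on_def
    by (auto intro: Ck_on_bounded_linear[OF _ bounded_linear_inner_left] Ck_on_id)
  from smooth_fun_comp_chart[OF open_dom subset_refl this] show ?thesis
    by (simp add: coord_def)
qed

lemma coord_smooth_at: "p \<in> U \<Longrightarrow> smooth_at A p (coord b)"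
  using smooth_atI[OF open_dom _ coord_smooth] .

lemma smooth_at_has_derivative:
  assumes "p \<in> U" "smooth_at A p f"
  shows "(f \<circ> inv_into U \<phi> has_derivative frechet_derivative (f \<circ> inv_into U \<phi>) (at (\<phi> p))) (at (\<phi> p))"
proof -
  obtain W where W: "open W" "p \<in> W" "smooth_fun A W f"
    using assms(2) by (auto simp: smooth_at_def)
  have "smooth_fun A (W \<inter> U) f"
    using smooth_fun_subset[OF W(3)] by blast
  then have "smooth_on (\<phi> ` (W \<inter> U)) (f \<circ> inv_into U \<phi>)"
    by (subst (asm) smooth_fun_iff) (use W open_dom in auto)
  then show ?thesis
    by (rule smooth_on_has_derivative) (use W assms in auto)
qed

lemma coord_vf_eq:
  assumes "p \<in> U" "smooth_at A p f" "(f \<circ> inv_into U \<phi> has_derivative D) (at (\<phi> p))"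
  shows "coord_vf b p f = D b"
  using assms(2) frechet_derivative_at[OF assms(3)] by (simp add: coord_vf_def)

lemma coord_vf_tangent:
  assumes p: "p \<in> U"
  shows "coord_vf b p \<in> tangent_space A p"
  unfolding tangent_space_def
proof (intro CollectI conjI allI impI)
  fix f g :: "'p \<Rightarrow> real" and c d :: real
  show "coord_vf b p f = 0" if "\<not> smooth_at A p f"
    using that by (simp add: coord_vf_def)
  assume fg: "smooth_at A p f" "smooth_at A p g"
  note D = smooth_at_has_derivative[OF p fg(1)] smooth_at_has_derivative[OF p fg(2)]
  show "coord_vf b p (\<lambda>q. c * f q + d * g q) = c * coord_vf b p f + d * coord_vf b p g"
  proof (subst coord_vf_eq[OF p])
    show "smooth_at A p (\<lambda>q. c * f q + d * g q)"
      using fg by (intro smooth_at_add smooth_at_mult smooth_at_const)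
    show "((\<lambda>q. c * f q + d * g q) \<circ> inv_into U \<phi> has_derivative
        (\<lambda>h. c * frechet_derivative (f \<circ> inv_into U \<phi>) (at (\<phi> p)) h
           + d * frechet_derivative (g \<circ> inv_into U \<phi>) (at (\<phi> p)) h)) (at (\<phi> p))"
      using has_derivative_add[OF has_derivative_mult_right[OF D(1)] has_derivative_mult_right[OF D(2)], of c d]
      by (simp add: o_def)
  qed (use fg in \<open>simp add: coord_vf_def\<close>)
  show "coord_vf b p (\<lambda>q. f q * g q) = f p * coord_vf b p g + g p * coord_vf b p f"
  proof (subst coord_vf_eq[OF p])
    show "smooth_at A p (\<lambda>q. f q * g q)"
      using fg by (intro smooth_at_mult)
    show "((\<lambda>q. f q * g q) \<circ> inv_into U \<phi> has_derivative
        (\<lambda>h. f p * frechet_derivative (g \<circ> inv_into U \<phi>) (at (\<phi> p)) h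
           + frechet_derivative (f \<circ> inv_into U \<phi>) (at (\<phi> p)) h * g p)) (at (\<phi> p))"
      using has_derivative_mult[OF D] by (simp add: o_def chart_inv[OF p])
  qed (use fg in \<open>simp add: coord_vf_def\<close>)
  assume "\<forall>\<^sub>F q in nhds p. f q = g q"
  then obtain V where V: "open V" "p \<in> V" "\<And>q. q \<in> V \<Longrightarrow> f q = g q"
    unfolding eventually_nhds by blast
  have "frechet_derivative (f \<circ> inv_into U \<phi>) (at (\<phi> p)) = frechet_derivative (g \<circ> inv_into U \<phi>) (at (\<phi> p))"
    by (rule frechet_derivative_cong_open[OF is_chart_open_image[OF chart V(1)]])
      (use V p in \<open>auto simp: chart_inv\<close>)
  then show "coord_vf b p f = coord_vf b p g"
    using fg by (simp add: coord_vf_def)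
qed

lemma coord_vf_vfields:
  assumes "b \<in> Basis"
  shows "coord_vf b \<in> vfields A U"
proof (rule vfieldsI[OF coord_vf_tangent])
  fix W f assume W: "open W" "W \<subseteq> U" "smooth_fun A W f"
  have "smooth_on (\<phi> ` W) (\<lambda>x. frechet_derivative (f \<circ> inv_into U \<phi>) (at x) b)"
    using W smooth_fun_iff by (intro smooth_on_frechet_derivative assms) auto
  from smooth_fun_comp_chart[OF W(1,2) this] show "smooth_fun A W (\<lambda>p. coord_vf b p f)"
    by (rule smooth_fun_cong[OF W(1), rotated])
      (use smooth_atI[OF W(1) _ W(3)] in \<open>auto simp: coord_vf_def\<close>)
qed

lemma coord_vf_coord:
  assumes "p \<in> U"
  shows "coord_vf b p (coord c) = b \<bullet> c"
proof (rule coord_vf_eq[OF assms coord_smooth_at[OF assms]])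
  have "((\<lambda>x. x \<bullet> c) has_derivative (\<lambda>h. h \<bullet> c)) (at (\<phi> p))"
    by (auto intro!: derivative_eq_intros)
  then show "(coord c \<circ> inv_into U \<phi> has_derivative (\<lambda>h. h \<bullet> c)) (at (\<phi> p))"
    by (rule has_derivative_transform_within_open[OF _ open_image[OF open_dom subset_refl]])
      (use assms in \<open>auto simp: coord_def chart_inv\<close>)
qed

text \<open>By Hadamard's lemma \<open>f\<close> is, near \<open>p\<close>, a constant plus a sum of
  products of coordinate differences with smooth functions. The differences vanish at
  \<open>p\<close>, so the product rule leaves only the derivatives of the coordinates, weighted by
  the partial derivatives of \<open>f\<close>.\<close>

lemma tangent_expansion:
  assumes p: "p \<in> U" and v: "v \<in> tangent_space A p"
  shows "v = (\<Sum>b\<in>Basis. v (coord b) *\<^sub>T coord_vf b p)"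
proof
  fix f
  have sum_apply: "(\<Sum>b\<in>Basis. v (coord b) *\<^sub>T coord_vf b p) f = (\<Sum>b\<in>Basis. v (coord b) * coord_vf b p f)"
    by (simp add: sum_fun_apply tscale_def)
  show "v f = (\<Sum>b\<in>Basis. v (coord b) *\<^sub>T coord_vf b p) f"
  proof (cases "smooth_at A p f")
    case False
    then show ?thesis
      unfolding sum_apply by (simp add: tangent_not_smooth[OF v] coord_vf_def)
  next
    case True
    then obtain W where W: "open W" "p \<in> W" "smooth_fun A W f"
      by (auto simp: smooth_at_def)
    have oW: "open (U \<inter> W)" "U \<inter> W \<subseteq> U" using W open_dom by auto
    have F: "smooth_on (\<phi> ` (U \<inter> W)) (f \<circ> inv_into U \<phi>)"
      using smooth_fun_subset[OF W(3), of "U \<inter> W"] smooth_fun_iff[OF oW] by auto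
    have "open (\<phi> ` (U \<inter> W))" "\<phi> p \<in> \<phi> ` (U \<inter> W)"
      using open_image[OF oW] W p by auto
    \<comment> \<open>Hadamard's lemma wants a convex domain, hence a ball in the chart image; its
      preimage \<open>V\<close> is the neighbourhood on which the expansion holds.\<close>
    then obtain r where r: "r > 0" "ball (\<phi> p) r \<subseteq> \<phi> ` (U \<inter> W)"
      by (rule openE)
    let ?B = "ball (\<phi> p) r"
    have centre: "\<phi> p \<in> ?B" using r by simp
    obtain g where g: "\<And>b. b \<in> Basis \<Longrightarrow> smooth_on ?B (g b)"
      "\<And>x. x \<in> ?B \<Longrightarrow> (f \<circ> inv_into U \<phi>) x = (f \<circ> inv_into U \<phi>) (\<phi> p)
          + (\<Sum>b\<in>Basis. ((x - \<phi> p) \<bullet> b) * g b x)"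
      "\<And>b. b \<in> Basis \<Longrightarrow> g b (\<phi> p) = frechet_derivative (f \<circ> inv_into U \<phi>) (at (\<phi> p)) b"
      by (rule hadamard_lemma[OF open_ball convex_ball centre smooth_on_subset[OF F r(2)]]) (rule that)
    define V where "V = U \<inter> \<phi> -` ?B"
    have V: "open V" "V \<subseteq> U" "p \<in> V"
      using is_chart_open_vimage[OF chart open_ball] p r by (auto simp: V_def)
    have gs: "smooth_at A p (\<lambda>q. g b (\<phi> q))" if "b \<in> Basis" for b
      by (rule smooth_atI[OF V(1,3) smooth_fun_comp_chart[OF V(1,2)]])
        (rule smooth_on_subset[OF g(1)[OF that]], auto simp: V_def)
    have cs: "smooth_at A p (\<lambda>q. coord b q - coord b p)" for b
      by (intro smooth_at_diff coord_smooth_at p smooth_at_const)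
    have "v f = v (\<lambda>q. f p + (\<Sum>b\<in>Basis. (coord b q - coord b p) * g b (\<phi> q)))"
    proof (rule tangent_cong[OF v])
      have "f q = f p + (\<Sum>b\<in>Basis. (coord b q - coord b p) * g b (\<phi> q))" if "q \<in> V" for q
        using g(2)[of "\<phi> q"] that p by (auto simp: V_def chart_inv coord_def inner_diff_left)
      then show "\<forall>\<^sub>F q in nhds p. f q = f p + (\<Sum>b\<in>Basis. (coord b q - coord b p) * g b (\<phi> q))"
        unfolding eventually_nhds using V by blast
    qed
    also have "\<dots> = v (\<lambda>q. \<Sum>b\<in>Basis. (coord b q - coord b p) * g b (\<phi> q))"
      using tangent_add[OF v smooth_at_const smooth_at_sum[OF smooth_at_mult[OF cs gs]]]
      by (simp add: tangent_const[OF v])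
    also have "\<dots> = (\<Sum>b\<in>Basis. v (\<lambda>q. (coord b q - coord b p) * g b (\<phi> q)))"
      using tangent_sum[OF v smooth_at_mult[OF cs gs]] .
    also have "\<dots> = (\<Sum>b\<in>Basis. v (coord b) * coord_vf b p f)"
    proof (rule sum.cong[OF refl])
      fix b :: 'e assume b: "b \<in> Basis"
      \<comment> \<open>The other term of the product rule has the factor
        \<open>coord b p - coord b p\<close>.\<close>
      have "v (\<lambda>q. (coord b q - coord b p) * g b (\<phi> q)) = g b (\<phi> p) * v (\<lambda>q. coord b q - coord b p)"
        using tangent_mult[OF v cs gs[OF b]] by simp
      also have "v (\<lambda>q. coord b q - coord b p) = v (coord b)"
        using tangent_diff[OF v coord_smooth_at[OF p] smooth_at_const] tangent_const[OF v] by simp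
      finally show "v (\<lambda>q. (coord b q - coord b p) * g b (\<phi> q)) = v (coord b) * coord_vf b p f"
        using True g(3)[OF b] by (simp add: coord_vf_def)
    qed
    finally show ?thesis by (simp only: sum_apply)
  qed
qed

end

section \<open>Riemannian metrics and orthogonal frames\<close>

locale riemannian_manifold = smooth_manifold A
  for A :: "('p::{t2_space,second_countable_topology}, 'e::euclidean_space) chart set" +
  fixes g :: "'p tensor02"
  assumes metric: "riemannian_metric A g"
begin

lemma metric_tensor: "tensor_field A g"
  using metric by (simp add: riemannian_metric_def symmetric_tensor_field_def)

lemma metric_smooth:
  "open U \<Longrightarrow> X \<in> vfields A U \<Longrightarrow> Y \<in> vfields A U \<Longrightarrow> smooth_fun A U (\<lambda>p. g p (X p) (Y p))"
  using metric_tensor unfolding tensor_field_def by simp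

lemma metric_sym: "u \<in> tangent_space A p \<Longrightarrow> v \<in> tangent_space A p \<Longrightarrow> g p u v = g p v u"
  using metric by (simp add: riemannian_metric_def symmetric_tensor_field_def)

lemma metric_pos: "u \<in> tangent_space A p \<Longrightarrow> u \<noteq> 0 \<Longrightarrow> g p u u > 0"
  using metric by (simp add: riemannian_metric_def)

lemma metric_lincomb_left:
  assumes "u \<in> tangent_space A p" "v \<in> tangent_space A p" "w \<in> tangent_space A p"
  shows "g p (a *\<^sub>T u + b *\<^sub>T v) w = a * g p u w + b * g p v w"
  using metric_tensor assms unfolding tensor_field_def by simp

lemma metric_add_left:
  assumes "u \<in> tangent_space A p" "v \<in> tangent_space A p" "w \<in> tangent_space A p"
  shows "g p (u + v) w = g p u w + g p v w"
proof -
  have "u + v = 1 *\<^sub>T u + 1 *\<^sub>T v" by (simp add: tscale_def)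
  then show ?thesis using metric_lincomb_left[OF assms, of 1 1] by simp
qed

lemma metric_diff_left:
  assumes "u \<in> tangent_space A p" "v \<in> tangent_space A p" "w \<in> tangent_space A p"
  shows "g p (u - v) w = g p u w - g p v w"
proof -
  have "u - v = 1 *\<^sub>T u + (-1) *\<^sub>T v" by (simp add: tscale_def fun_eq_iff)
  then show ?thesis using metric_lincomb_left[OF assms, of 1 "-1"] by simp
qed

lemma metric_scale_left:
  assumes "u \<in> tangent_space A p" "w \<in> tangent_space A p"
  shows "g p (a *\<^sub>T u) w = a * g p u w"
proof -
  have "a *\<^sub>T u = a *\<^sub>T u + 0 *\<^sub>T u" by (simp add: tscale_def fun_eq_iff)
  then show ?thesis using metric_lincomb_left[OF assms(1,1,2), of a 0] by simp
qed

lemma metric_zero_left: "w \<in> tangent_space A p \<Longrightarrow> g p 0 w = 0"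
  using metric_diff_left[of 0 p 0 w] tangent_space_zero by simp

lemma metric_uminus_left:
  assumes "u \<in> tangent_space A p" "w \<in> tangent_space A p"
  shows "g p (- u) w = - g p u w"
  using metric_diff_left[OF tangent_space_zero assms] metric_zero_left[OF assms(2)] by simp

lemma metric_sum_left:
  assumes "\<And>i. i \<in> J \<Longrightarrow> u i \<in> tangent_space A p" "w \<in> tangent_space A p"
  shows "g p (\<Sum>i\<in>J. c i *\<^sub>T u i) w = (\<Sum>i\<in>J. c i * g p (u i) w)"
  using assms(1)
proof (induction J rule: infinite_finite_induct)
  case (insert i J)
  then have "g p (c i *\<^sub>T u i + (\<Sum>i\<in>J. c i *\<^sub>T u i)) w = c i * g p (u i) w + (\<Sum>i\<in>J. c i * g p (u i) w)"
    by (subst metric_add_left) (auto intro!: tangent_space_scale tangent_space_sum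
        simp: assms(2) metric_scale_left)
  then show ?case
    unfolding sum.insert[OF insert.hyps] .
qed (simp_all add: metric_zero_left[OF assms(2)])

lemma metric_add_right:
  assumes "u \<in> tangent_space A p" "v \<in> tangent_space A p" "w \<in> tangent_space A p"
  shows "g p w (u + v) = g p w u + g p w v"
  using metric_add_left[OF assms] assms by (simp add: metric_sym[of _ p w] tangent_space_add)

lemma metric_scale_right:
  assumes "u \<in> tangent_space A p" "w \<in> tangent_space A p"
  shows "g p w (a *\<^sub>T u) = a * g p w u"
  using metric_scale_left[OF assms] assms by (simp add: metric_sym[of _ p w] tangent_space_scale)

lemma metric_eqI:
  assumes "u \<in> tangent_space A p" "v \<in> tangent_space A p"
    "\<And>w. w \<in> tangent_space A p \<Longrightarrow> g p u w = g p v w"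
  shows "u = v"
proof (rule ccontr)
  assume "u \<noteq> v"
  then have "g p (u - v) (u - v) > 0"
    using assms by (intro metric_pos tangent_space_diff) auto
  then show False
    using assms by (simp add: metric_diff_left tangent_space_diff)
qed

end

text \<open>The vectors are not normalised: dividing by squared lengths keeps the coefficients free
  of square roots.\<close>

fun gram_schmidt :: "'p tensor02 \<Rightarrow> (nat \<Rightarrow> 'p vfield) \<Rightarrow> nat \<Rightarrow> 'p vfield" where
  "gram_schmidt g X k = (\<lambda>p. X k p - (\<Sum>j<k.
     (g p (X k p) (gram_schmidt g X j p) / g p (gram_schmidt g X j p) (gram_schmidt g X j p))
       *\<^sub>T gram_schmidt g X j p))"

text \<open>As a rewrite rule the equation would keep unfolding inside its own right-hand
  side.\<close>

declare gram_schmidt.simps [simp del]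

text \<open>The enumeration is a parameter because Gram-Schmidt depends on the order: adapted frames
  need a prescribed one.\<close>

locale riemannian_chart = compatible_chart A U \<phi> + riemannian_manifold A g
  for A :: "('p::{t2_space,second_countable_topology}, 'e::euclidean_space) chart set"
    and U \<phi> g +
  fixes e :: "nat \<Rightarrow> 'e" and N :: nat
  assumes enum: "bij_betw e {..<N} Basis"
begin

definition frame :: "nat \<Rightarrow> 'p vfield" where
  "frame = gram_schmidt g (\<lambda>k. coord_vf (e k))"

definition coeff :: "'p vfield \<Rightarrow> nat \<Rightarrow> 'p \<Rightarrow> real" where
  "coeff X j p = g p (X p) (frame j p) / g p (frame j p) (frame j p)"

lemma frame_eq:
  "frame k p = coord_vf (e k) p - (\<Sum>j<k. coeff (coord_vf (e k)) j p *\<^sub>T frame j p)"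
  unfolding frame_def coeff_def by (subst gram_schmidt.simps) (rule refl)

lemma enum_Basis: "k < N \<Longrightarrow> e k \<in> Basis"
  using enum by (auto simp: bij_betw_def)

lemma enum_inner: "j < N \<Longrightarrow> k < N \<Longrightarrow> e j \<bullet> e k = (if j = k then 1 else 0)"
  using enum enum_Basis by (auto simp: inner_Basis bij_betw_def inj_on_def)

text \<open>The transition matrix to the coordinate frame is unitriangular, so no frame vector vanishes.\<close>

lemma frame_properties:
  assumes "k < N"
  shows "frame k \<in> vfields A U \<and>
    (\<forall>p\<in>U. \<forall>i. k \<le> i \<longrightarrow> i < N \<longrightarrow> frame k p (coord (e i)) = (if i = k then 1 else 0)) \<and>
    (\<forall>p\<in>U. 0 < g p (frame k p) (frame k p)) \<and>
    (\<forall>p\<in>U. \<forall>j<k. g p (frame k p) (frame j p) = 0)"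
  using assms
\<comment> \<open>The properties depend on each other: the coefficients are smooth because earlier
  vectors have positive length, positive length follows from triangularity, and orthogonality to one
  earlier vector uses that the earlier ones are mutually orthogonal.\<close>
proof (induction k rule: less_induct)
  case (less k)
  let ?X = "coord_vf (e k)"
  have X: "?X \<in> vfields A U"
    using coord_vf_vfields[OF enum_Basis[OF less.prems]] .
  have E: "frame j \<in> vfields A U" if "j < k" for j
    using less that by auto
  have pos: "g p (frame j p) (frame j p) > 0" if "j < k" "p \<in> U" for j p
    using less.IH[of j] less.prems that by auto
  have orth: "g p (frame i p) (frame j p) = 0" if "i < k" "j < k" "i \<noteq> j" "p \<in> U" for i j p
  proof (cases "i < j")
    case True
    then have "g p (frame j p) (frame i p) = 0"
      using less.IH[of j] less.prems that by auto
    then show ?thesis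
      using metric_sym vfields_tangent[OF E that(4)] that by simp
  next
    case False
    then show ?thesis
      using less.IH[of i] less.prems that by auto
  qed
  have cs: "smooth_fun A U (coeff ?X j)" if "j < k" for j
    unfolding coeff_def
    by (intro smooth_fun_divide open_dom metric_smooth X E that) (use pos[OF that] in force)
  have vf: "frame k \<in> vfields A U"
  proof (rule vfields_cong)
    show "?X + fscale (\<lambda>_. -1) (\<Sum>j<k. fscale (coeff ?X j) (frame j)) \<in> vfields A U"
      using cs E by (intro vfields_add vfields_fscale vfields_sum open_dom X smooth_fun_const) auto
    show "(?X + fscale (\<lambda>_. -1) (\<Sum>j<k. fscale (coeff ?X j) (frame j))) p = frame k p" for p
      by (subst frame_eq) (simp add: fscale_def sum_fun_apply tscale_def fun_eq_iff)
  qed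
  have T: "?X p \<in> tangent_space A p" "\<And>j. j < k \<Longrightarrow> frame j p \<in> tangent_space A p" if "p \<in> U" for p
    using that vfields_tangent[OF X] vfields_tangent[OF E] by auto
  have tri: "frame k p (coord (e i)) = (if i = k then 1 else 0)" if "p \<in> U" "k \<le> i" "i < N" for p i
  proof -
    have "frame j p (coord (e i)) = 0" if "j < k" for j
      using less.IH[OF that] less.prems that \<open>p \<in> U\<close> \<open>k \<le> i\<close> \<open>i < N\<close> by auto
    then show ?thesis
      using that less.prems enum_inner
      by (subst frame_eq) (simp add: sum_fun_apply tscale_def coord_vf_coord)
  qed
  have "frame k p \<noteq> 0" if "p \<in> U" for p
    using tri[OF that, of k] less.prems by auto
  then have pos_k: "g p (frame k p) (frame k p) > 0" if "p \<in> U" for p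
    using that vfields_tangent[OF vf] by (intro metric_pos) auto
  have orth_k: "g p (frame k p) (frame j p) = 0" if "p \<in> U" "j < k" for p j
  proof -
    have "g p (frame k p) (frame j p)
        = g p (?X p) (frame j p) - (\<Sum>i<k. coeff ?X i p * g p (frame i p) (frame j p))"
    proof -
      have "(\<Sum>i<k. coeff ?X i p *\<^sub>T frame i p) \<in> tangent_space A p"
        using T(2)[OF that(1)] by (intro tangent_space_sum tangent_space_scale) auto
      then show ?thesis
        by (subst frame_eq, subst metric_diff_left[OF T(1)[OF that(1)] _ T(2)[OF that]])
          (use T(2)[OF that(1)] that(2) in \<open>auto intro!: metric_sum_left\<close>)
    qed
    \<comment> \<open>Only \<open>i = j\<close> survives, and \<open>coeff\<close> is the number for
      which this term cancels the first.\<close>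
    also have "(\<Sum>i<k. coeff ?X i p * g p (frame i p) (frame j p))
        = (\<Sum>i\<in>{j}. coeff ?X i p * g p (frame i p) (frame j p))"
      by (rule sum.mono_neutral_right) (use that orth in auto)
    finally show ?thesis
      using pos[OF that(2,1)] by (simp add: coeff_def)
  qed
  show ?case
    using vf tri pos_k orth_k by blast
qed

lemma frame_vfields: "k < N \<Longrightarrow> frame k \<in> vfields A U"
  using frame_properties by blast

lemma frame_tangent: "k < N \<Longrightarrow> p \<in> U \<Longrightarrow> frame k p \<in> tangent_space A p"
  using vfields_tangent[OF frame_vfields] .

lemma frame_pos: "k < N \<Longrightarrow> p \<in> U \<Longrightarrow> 0 < g p (frame k p) (frame k p)"
  using frame_properties by blast

lemma frame_orth:
  assumes "j < N" "k < N" "j \<noteq> k" "p \<in> U"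
  shows "g p (frame j p) (frame k p) = 0"
proof (cases "j < k")
  case True
  then have "g p (frame k p) (frame j p) = 0"
    using frame_properties[of k] assms by blast
  then show ?thesis
    using metric_sym[OF frame_tangent frame_tangent] assms by simp
next
  case False
  then show ?thesis
    using frame_properties[of j] assms by auto
qed

lemma coord_vf_frame:
  "coord_vf (e k) p = frame k p + (\<Sum>j<k. coeff (coord_vf (e k)) j p *\<^sub>T frame j p)"
  by (subst frame_eq) simp

lemma frame_sum_inner:
  assumes "p \<in> U" "k < N"
  shows "g p (\<Sum>j<N. c j *\<^sub>T frame j p) (frame k p) = c k * g p (frame k p) (frame k p)"
proof -
  have "g p (\<Sum>j<N. c j *\<^sub>T frame j p) (frame k p) = (\<Sum>j<N. c j * g p (frame j p) (frame k p))"
    using assms by (intro metric_sum_left frame_tangent) auto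
  also have "\<dots> = (\<Sum>j\<in>{k}. c j * g p (frame j p) (frame k p))"
    by (rule sum.mono_neutral_right) (use assms frame_orth in auto)
  finally show ?thesis by simp
qed

lemma tangent_expansion_enum:
  assumes "p \<in> U" "v \<in> tangent_space A p"
  shows "v = (\<Sum>k<N. v (coord (e k)) *\<^sub>T coord_vf (e k) p)"
proof -
  have "(\<Sum>k<N. v (coord (e k)) *\<^sub>T coord_vf (e k) p) = (\<Sum>b\<in>Basis. v (coord b) *\<^sub>T coord_vf b p)"
    by (rule sum.reindex_bij_betw[OF enum])
  then show ?thesis
    using tangent_expansion[OF assms] by simp
qed

text \<open>The remainder \<open>w\<close> is orthogonal to the frame. Each coordinate vector is a
  combination of frame vectors, so \<open>w\<close> is orthogonal to all coordinate vectors, hence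
  to itself, and definiteness gives 0.\<close>

lemma frame_expansion:
  assumes p: "p \<in> U" and v: "v \<in> tangent_space A p"
  shows "v = (\<Sum>k<N. (g p v (frame k p) / g p (frame k p) (frame k p)) *\<^sub>T frame k p)"
    (is "v = ?s")
proof -
  have s: "?s \<in> tangent_space A p"
    using p frame_tangent by (intro tangent_space_sum tangent_space_scale) auto
  define w where "w = v - ?s"
  have w: "w \<in> tangent_space A p"
    unfolding w_def using v s by (rule tangent_space_diff)
  have wE: "g p (frame k p) w = 0" if "k < N" for k
  proof -
    have "g p w (frame k p) = 0"
      using frame_pos[OF that p] frame_sum_inner[OF p that]
      by (simp add: w_def metric_diff_left[OF v s frame_tangent[OF that p]])
    then show ?thesis
      using metric_sym[OF w frame_tangent[OF that p]] by simp
  qed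
  have wX: "g p (coord_vf (e k) p) w = 0" if "k < N" for k
  proof -
    have "g p (\<Sum>j<k. coeff (coord_vf (e k)) j p *\<^sub>T frame j p) w = 0"
      using that p wE frame_tangent by (subst metric_sum_left) (auto simp: w)
    moreover have "(\<Sum>j<k. coeff (coord_vf (e k)) j p *\<^sub>T frame j p) \<in> tangent_space A p"
      using that p frame_tangent by (intro tangent_space_sum tangent_space_scale) auto
    ultimately show ?thesis
      by (subst coord_vf_frame, subst metric_add_left[OF frame_tangent[OF that p] _ w])
        (use wE[OF that] in auto)
  qed
  have "g p (\<Sum>k<N. w (coord (e k)) *\<^sub>T coord_vf (e k) p) w = 0"
    using wX p coord_vf_tangent by (subst metric_sum_left) (auto simp: w)
  then have "g p w w = 0"
    using tangent_expansion_enum[OF p w] by simp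
  then have "w = 0"
    using metric_pos[OF w] by force
  then show ?thesis
    by (simp add: w_def)
qed

end

section \<open>The Koszul formula and the Levi-Civita connection\<close>

definition koszul ::
    "('p::topological_space, 'e::euclidean_space) chart set \<Rightarrow> 'p tensor02 \<Rightarrow>
     'p vfield \<Rightarrow> 'p vfield \<Rightarrow> 'p vfield \<Rightarrow> 'p \<Rightarrow> real" where
  "koszul A g X Y Z p =
     X p (\<lambda>q. g q (Y q) (Z q)) + Y p (\<lambda>q. g q (X q) (Z q)) - Z p (\<lambda>q. g q (X q) (Y q))
     + g p (lie_bracket A X Y p) (Z p) - g p (lie_bracket A X Z p) (Y p) - g p (lie_bracket A Y Z p) (X p)"

section \<open>Algebra of the Koszul expression\<close>

context riemannian_manifold
begin

lemma metric_smooth_at: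
  "open U \<Longrightarrow> p \<in> U \<Longrightarrow> X \<in> vfields A U \<Longrightarrow> Y \<in> vfields A U \<Longrightarrow> smooth_at A p (\<lambda>q. g q (X q) (Y q))"
  using smooth_atI metric_smooth by blast

lemma tangent_metric_sym:
  assumes "open U" "p \<in> U" "v \<in> tangent_space A p" "X \<in> vfields A U" "Y \<in> vfields A U"
  shows "v (\<lambda>q. g q (Y q) (X q)) = v (\<lambda>q. g q (X q) (Y q))"
proof (rule tangent_cong[OF assms(3)])
  have "g q (Y q) (X q) = g q (X q) (Y q)" if "q \<in> U" for q
    using metric_sym vfields_tangent assms(4,5) that by blast
  then show "\<forall>\<^sub>F q in nhds p. g q (Y q) (X q) = g q (X q) (Y q)"
    unfolding eventually_nhds using assms(1,2) by blast
qed

lemma tangent_metric_add: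
  assumes "open U" "p \<in> U" "v \<in> tangent_space A p" "X \<in> vfields A U" "Y \<in> vfields A U" "Z \<in> vfields A U"
  shows "v (\<lambda>q. g q (X q) ((Y + Z) q)) = v (\<lambda>q. g q (X q) (Y q)) + v (\<lambda>q. g q (X q) (Z q))"
proof -
  have "g q (X q) ((Y + Z) q) = g q (X q) (Y q) + g q (X q) (Z q)" if "q \<in> U" for q
    using metric_add_right[OF assms(5,6,4)[THEN vfields_tangent, OF that]] by simp
  then have "v (\<lambda>q. g q (X q) ((Y + Z) q)) = v (\<lambda>q. g q (X q) (Y q) + g q (X q) (Z q))"
    using assms(1,2) by (intro tangent_cong[OF assms(3)]) (unfold eventually_nhds, blast)
  then show ?thesis
    using tangent_add[OF assms(3) metric_smooth_at[OF assms(1,2,4,5)] metric_smooth_at[OF assms(1,2,4,6)]]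
    by simp
qed

lemma tangent_metric_fscale:
  assumes "open U" "p \<in> U" "v \<in> tangent_space A p" "X \<in> vfields A U" "Y \<in> vfields A U" "smooth_fun A U f"
  shows "v (\<lambda>q. g q (X q) (fscale f Y q)) = v f * g p (X p) (Y p) + f p * v (\<lambda>q. g q (X q) (Y q))"
proof -
  have "g q (X q) (fscale f Y q) = f q * g q (X q) (Y q)" if "q \<in> U" for q
    using metric_scale_right[OF assms(5,4)[THEN vfields_tangent, OF that]] by (simp add: fscale_def)
  then have "v (\<lambda>q. g q (X q) (fscale f Y q)) = v (\<lambda>q. f q * g q (X q) (Y q))"
    using assms(1,2) by (intro tangent_cong[OF assms(3)]) (unfold eventually_nhds, blast)
  then show ?thesis
    using tangent_mult[OF assms(3) smooth_atI[OF assms(1,2,6)] metric_smooth_at[OF assms(1,2,4,5)]]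
    by simp
qed

text \<open>Allows \<open>Z\<close> to be replaced by its frame expansion, which is available only
  on the domain of the frame.\<close>

lemma koszul_cong_right:
  assumes U: "open U" "p \<in> U" and X: "X \<in> vfields A U" and Y: "Y \<in> vfields A U"
    and eq: "\<And>q. q \<in> U \<Longrightarrow> Z q = Z' q"
  shows "koszul A g X Y Z p = koszul A g X Y Z' p"
proof -
  have near: "\<forall>\<^sub>F q in nhds p. g q (V q) (Z q) = g q (V q) (Z' q)" for V
    unfolding eventually_nhds using U eq by (intro exI[of _ U]) auto
  have "X p (\<lambda>q. g q (Y q) (Z q)) = X p (\<lambda>q. g q (Y q) (Z' q))"
    by (rule tangent_cong[OF vfields_tangent[OF X U(2)] near])
  moreover have "Y p (\<lambda>q. g q (X q) (Z q)) = Y p (\<lambda>q. g q (X q) (Z' q))"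
    by (rule tangent_cong[OF vfields_tangent[OF Y U(2)] near])
  moreover have "lie_bracket A X Z p = lie_bracket A X Z' p" "lie_bracket A Y Z p = lie_bracket A Y Z' p"
    by (rule lie_bracket_cong_right[OF U _ eq], rule vfields_tangent[OF X U(2)], assumption)
      (rule lie_bracket_cong_right[OF U _ eq], rule vfields_tangent[OF Y U(2)], assumption)
  ultimately show ?thesis
    using eq[OF U(2)] by (simp add: koszul_def)
qed

lemma koszul_add_right:
  assumes U: "open U" "p \<in> U" and X: "X \<in> vfields A U" and Y: "Y \<in> vfields A U"
    and Z: "Z \<in> vfields A U" and W: "W \<in> vfields A U"
  shows "koszul A g X Y (Z + W) p = koszul A g X Y Z p + koszul A g X Y W p"
proof -
  note T = vfields_tangent[OF X U(2)] vfields_tangent[OF Y U(2)] vfields_tangent[OF Z U(2)] vfields_tangent[OF W U(2)]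
    lie_bracket_tangent[OF U X Y] lie_bracket_tangent[OF U X Z] lie_bracket_tangent[OF U X W]
    lie_bracket_tangent[OF U Y Z] lie_bracket_tangent[OF U Y W]
  show ?thesis
    unfolding koszul_def
    using T by (simp add: tangent_metric_add[OF U T(1) Y Z W] tangent_metric_add[OF U T(2) X Z W]
        lie_bracket_add_right[OF U X Z W] lie_bracket_add_right[OF U Y Z W] metric_add_left metric_add_right
        del: plus_fun_apply)
      (simp add: metric_add_right)
qed

text \<open>The derivatives of \<open>f\<close> in the two metric terms, (X f) g(Y, Z) and (Y f)
  g(X, Z), are cancelled by those from the brackets [X, fZ] and [Y, fZ]. This tensoriality makes the
  expression a pairing with a vector.\<close>

lemma koszul_fscale_right:
  assumes U: "open U" "p \<in> U" and X: "X \<in> vfields A U" and Y: "Y \<in> vfields A U"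
    and Z: "Z \<in> vfields A U" and f: "smooth_fun A U f"
  shows "koszul A g X Y (fscale f Z) p = f p * koszul A g X Y Z p"
proof -
  note T = vfields_tangent[OF X U(2)] vfields_tangent[OF Y U(2)] vfields_tangent[OF Z U(2)]
    lie_bracket_tangent[OF U X Y] lie_bracket_tangent[OF U X Z] lie_bracket_tangent[OF U Y Z]
  have 1: "g p (lie_bracket A V (fscale f Z) p) w = V p f * g p w (Z p) + f p * g p (lie_bracket A V Z p) w"
    if "V \<in> vfields A U" "w \<in> tangent_space A p" for V w
    using that T(3) lie_bracket_tangent[OF U that(1) Z]
    by (simp add: lie_bracket_fscale_right[OF U that(1) Z f] metric_lincomb_left metric_sym[OF that(2) T(3)])
  have 2: "fscale f Z p h = f p * Z p h" for h
    by (simp add: fscale_def tscale_def)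
  have 3: "g p w (fscale f Z p) = f p * g p w (Z p)" if "w \<in> tangent_space A p" for w
    using metric_scale_right[OF T(3) that] by (simp add: fscale_def)
  show ?thesis
    unfolding koszul_def
    by (simp add: tangent_metric_fscale[OF U T(1) Y Z f] tangent_metric_fscale[OF U T(2) X Z f]
        1[OF X T(2)] 1[OF Y T(1)] 2 3[OF T(4)] algebra_simps)
qed

lemma koszul_sum_right:
  assumes U: "open U" "p \<in> U" and X: "X \<in> vfields A U" and Y: "Y \<in> vfields A U"
    and Z: "\<And>i. i \<in> J \<Longrightarrow> Z i \<in> vfields A U" and f: "\<And>i. i \<in> J \<Longrightarrow> smooth_fun A U (f i)"
  shows "koszul A g X Y (\<Sum>i\<in>J. fscale (f i) (Z i)) p = (\<Sum>i\<in>J. f i p * koszul A g X Y (Z i) p)"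
proof -
  have zero: "koszul A g X Y 0 p = 0"
  proof -
    have "fscale (\<lambda>_. 0) 0 = (0 :: 'p vfield)"
      by (simp add: fscale_def tscale_def fun_eq_iff)
    then show ?thesis
      using koszul_fscale_right[OF U X Y vfields_zero smooth_fun_const, of 0] by simp
  qed
  show ?thesis
    using Z f
  proof (induction J rule: infinite_finite_induct)
    case (insert i J)
    then have "koszul A g X Y (fscale (f i) (Z i) + (\<Sum>i\<in>J. fscale (f i) (Z i))) p
        = f i p * koszul A g X Y (Z i) p + (\<Sum>i\<in>J. f i p * koszul A g X Y (Z i) p)"
      by (subst koszul_add_right[OF U X Y])
        (auto intro!: vfields_fscale vfields_sum U(1) simp: koszul_fscale_right[OF U X Y])
    then show ?case
      unfolding sum.insert[OF insert.hyps] .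
  qed (simp_all add: zero)
qed

text \<open>Torsion-freeness before a connection exists. It is written with [Y, X] so that rules for
  the second slot of a bracket apply to the field moved out of the first argument.\<close>

lemma koszul_swap:
  assumes U: "open U" "p \<in> U" and X: "X \<in> vfields A U" and Y: "Y \<in> vfields A U" and Z: "Z \<in> vfields A U"
  shows "koszul A g X Y Z p = koszul A g Y X Z p - 2 * g p (lie_bracket A Y X p) (Z p)"
  unfolding koszul_def lie_bracket_antisym[of Y X]
  using tangent_metric_sym[OF U vfields_tangent[OF Z U(2)] X Y]
    metric_uminus_left[OF lie_bracket_tangent[OF U X Y] vfields_tangent[OF Z U(2)]]
  by simp

text \<open>Metric compatibility before a connection exists. It moves the middle argument to the
  right, so that the rules for the middle follow from those for the right;
  \<open>koszul_swap\<close> does the same for the left.\<close>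

lemma koszul_skew:
  assumes U: "open U" "p \<in> U" and X: "X \<in> vfields A U" and Y: "Y \<in> vfields A U" and Z: "Z \<in> vfields A U"
  shows "koszul A g X Y Z p = 2 * X p (\<lambda>q. g q (Z q) (Y q)) - koszul A g X Z Y p"
  unfolding koszul_def lie_bracket_antisym[of Z Y]
  using tangent_metric_sym[OF U vfields_tangent[OF X U(2)] Y Z]
    metric_uminus_left[OF lie_bracket_tangent[OF U Y Z] vfields_tangent[OF X U(2)]]
  by simp

lemma koszul_add_middle:
  assumes U: "open U" "p \<in> U" and X: "X \<in> vfields A U" and Y: "Y \<in> vfields A U"
    and W: "W \<in> vfields A U" and Z: "Z \<in> vfields A U"
  shows "koszul A g X (Y + W) Z p = koszul A g X Y Z p + koszul A g X W Z p"
  by (simp only: koszul_skew[OF U X vfields_add[OF U(1) Y W] Z] koszul_skew[OF U X Y Z]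
      koszul_skew[OF U X W Z] tangent_metric_add[OF U vfields_tangent[OF X U(2)] Z Y W]
      koszul_add_right[OF U X Z Y W]) simp

text \<open>The extra term is twice the one in the product rule of a connection, paired with
  \<open>Z\<close>; it comes from differentiating \<open>f\<close> in
  \<open>koszul_skew\<close>.\<close>

lemma koszul_fscale_middle:
  assumes U: "open U" "p \<in> U" and X: "X \<in> vfields A U" and Y: "Y \<in> vfields A U"
    and Z: "Z \<in> vfields A U" and f: "smooth_fun A U f"
  shows "koszul A g X (fscale f Y) Z p = 2 * X p f * g p (Y p) (Z p) + f p * koszul A g X Y Z p"
  by (simp only: koszul_skew[OF U X vfields_fscale[OF U(1) Y f] Z] koszul_skew[OF U X Y Z]
      tangent_metric_fscale[OF U vfields_tangent[OF X U(2)] Z Y f] koszul_fscale_right[OF U X Z Y f]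
      metric_sym[OF vfields_tangent[OF Y U(2)] vfields_tangent[OF Z U(2)]])
    (simp add: algebra_simps)

lemma koszul_add_left:
  assumes U: "open U" "p \<in> U" and X: "X \<in> vfields A U" and W: "W \<in> vfields A U"
    and Y: "Y \<in> vfields A U" and Z: "Z \<in> vfields A U"
  shows "koszul A g (X + W) Y Z p = koszul A g X Y Z p + koszul A g W Y Z p"
  by (simp only: koszul_swap[OF U vfields_add[OF U(1) X W] Y Z] koszul_swap[OF U X Y Z]
      koszul_swap[OF U W Y Z] koszul_add_middle[OF U Y X W Z] lie_bracket_add_right[OF U Y X W]
      metric_add_left[OF lie_bracket_tangent[OF U Y X] lie_bracket_tangent[OF U Y W] vfields_tangent[OF Z U(2)]])
    simp

text \<open>The product rule term from the middle slot, 2 (Y f) g(X, Z), is cancelled by the one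
  from the bracket [Y, fX].\<close>

lemma koszul_fscale_left:
  assumes U: "open U" "p \<in> U" and X: "X \<in> vfields A U" and Y: "Y \<in> vfields A U"
    and Z: "Z \<in> vfields A U" and f: "smooth_fun A U f"
  shows "koszul A g (fscale f X) Y Z p = f p * koszul A g X Y Z p"
  by (simp only: koszul_swap[OF U vfields_fscale[OF U(1) X f] Y Z] koszul_swap[OF U X Y Z]
      koszul_fscale_middle[OF U Y X Z f] lie_bracket_fscale_right[OF U Y X f]
      metric_lincomb_left[OF vfields_tangent[OF X U(2)] lie_bracket_tangent[OF U Y X] vfields_tangent[OF Z U(2)]])
    (simp add: algebra_simps)

lemma koszul_smooth:
  assumes "open U" "X \<in> vfields A U" "Y \<in> vfields A U" "Z \<in> vfields A U"
  shows "smooth_fun A U (koszul A g X Y Z)"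
proof -
  note vf = assms(2-4)[THEN vfields_smooth, OF assms(1) subset_refl]
  show ?thesis
    unfolding koszul_def[abs_def]
    by (intro smooth_fun_add smooth_fun_diff vf metric_smooth lie_bracket_vfields assms)
qed

text \<open>Compatibility rewrites the derivatives of the metric and torsion-freeness the brackets;
  of the twelve resulting terms all but two equal ones cancel.\<close>

lemma levi_civita_koszul:
  assumes D: "is_levi_civita A g D" and U: "open U" "p \<in> U"
    and X: "X \<in> vfields A U" and Y: "Y \<in> vfields A U" and Z: "Z \<in> vfields A U"
  shows "2 * g p (D X Y p) (Z p) = koszul A g X Y Z p"
proof -
  have vf: "D V W \<in> vfields A U" if "V \<in> vfields A U" "W \<in> vfields A U" for V W
    using D U(1) that by (simp add: is_levi_civita_def affine_connection_def)
  note T = vfields_tangent[OF _ U(2)]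
  have tor: "lie_bracket A V W p = D V W p - D W V p" if "V \<in> vfields A U" "W \<in> vfields A U" for V W
    using D U that unfolding is_levi_civita_def by metis
  \<comment> \<open>Symmetry puts the covariant derivative into the first slot of both terms, so
    that the terms literally match when cancelled.\<close>
  have met: "V p (\<lambda>q. g q (W q) (W' q)) = g p (D V W p) (W' p) + g p (D V W' p) (W p)"
    if V: "V \<in> vfields A U" "W \<in> vfields A U" "W' \<in> vfields A U" for V W W'
    using D U V metric_sym[OF T[OF vf[OF V(1,3)]] T[OF V(2)]] unfolding is_levi_civita_def by simp
  show ?thesis
    unfolding koszul_def
    by (simp add: tor met X Y Z metric_diff_left T vf)
qed

end

context riemannian_chart
begin

text \<open>Testing against one frame vector forces the coefficient, by orthogonality. Linearity
  over functions in the last argument extends the identity from frame vectors to arbitrary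
  \<open>Z\<close>.\<close>

lemma koszul_representation:
  assumes V: "open V" "p \<in> V" and p: "p \<in> U"
    and X: "X \<in> vfields A V" and Y: "Y \<in> vfields A V" and Z: "Z \<in> vfields A V"
  shows "2 * g p (\<Sum>k<N. (koszul A g X Y (frame k) p / (2 * g p (frame k p) (frame k p))) *\<^sub>T frame k p) (Z p)
    = koszul A g X Y Z p"
proof -
  let ?c = "\<lambda>k. koszul A g X Y (frame k) p / (2 * g p (frame k p) (frame k p))"
  let ?w = "\<Sum>k<N. ?c k *\<^sub>T frame k p"
  let ?W = "U \<inter> V"
  have W: "open ?W" "p \<in> ?W" using V p open_dom by auto
  have vf: "X \<in> vfields A ?W" "Y \<in> vfields A ?W" "Z \<in> vfields A ?W"
    using X Y Z vfields_subset by auto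
  have E: "frame k \<in> vfields A ?W" if "k < N" for k
    using vfields_subset[OF frame_vfields[OF that]] by simp
  have cs: "smooth_fun A ?W (coeff Z k)" if "k < N" for k
    unfolding coeff_def
    by (intro smooth_fun_divide W metric_smooth vf E that) (use frame_pos[OF that] in force)
  have Zeq: "Z q = (\<Sum>k<N. fscale (coeff Z k) (frame k)) q" if "q \<in> ?W" for q
    using frame_expansion[OF _ vfields_tangent[OF Z], of q] that
    by (simp add: sum_fun_apply fscale_def coeff_def)
  have w: "?w \<in> tangent_space A p"
    using p frame_tangent by (intro tangent_space_sum tangent_space_scale) auto
  have "koszul A g X Y Z p = koszul A g X Y (\<Sum>k<N. fscale (coeff Z k) (frame k)) p"
    by (rule koszul_cong_right[OF W vf(1,2) Zeq])
  also have "\<dots> = (\<Sum>k<N. coeff Z k p * koszul A g X Y (frame k) p)"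
    by (rule koszul_sum_right[OF W vf(1,2)]) (use E cs in auto)
  also have "\<dots> = (\<Sum>k<N. coeff Z k p * (2 * g p (frame k p) ?w))"
  proof (rule sum.cong[OF refl])
    fix k assume "k \<in> {..<N}"
    then have k: "k < N" by simp
    have "g p (frame k p) ?w = ?c k * g p (frame k p) (frame k p)"
      using frame_sum_inner[OF p k, of ?c] metric_sym[OF w frame_tangent[OF k p]] by simp
    then show "coeff Z k p * koszul A g X Y (frame k) p = coeff Z k p * (2 * g p (frame k p) ?w)"
      using frame_pos[OF k p] by simp
  qed
  also have "\<dots> = 2 * g p (\<Sum>k<N. coeff Z k p *\<^sub>T frame k p) ?w"
    using p frame_tangent w by (subst metric_sum_left) (auto simp: sum_distrib_left algebra_simps)
  also have "(\<Sum>k<N. coeff Z k p *\<^sub>T frame k p) = Z p"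
    using Zeq[OF W(2)] by (simp add: sum_fun_apply fscale_def)
  finally show ?thesis
    using metric_sym[OF w vfields_tangent[OF Z V(2)]] by simp
qed

lemma frame_extension:
  "J \<subseteq> {..<N} \<Longrightarrow> (\<Sum>k\<in>J. fscale (\<lambda>_. c k) (frame k)) \<in> vfields A U"
  using frame_vfields by (intro vfields_sum vfields_fscale open_dom smooth_fun_const) auto

end

section \<open>Existence of the Levi-Civita connection\<close>

context riemannian_manifold
begin

lemma riemannian_chart_around:
  obtains U \<phi> e N where "riemannian_chart A U \<phi> g e N" "p \<in> U"
proof -
  obtain U \<phi> where U: "(U, \<phi>) \<in> A" "p \<in> U" by (rule chart_around)
  obtain e :: "nat \<Rightarrow> 'e" where "bij_betw e {0..<card (Basis :: 'e set)} Basis"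
    using ex_bij_betw_nat_finite finite_Basis by blast
  then have "riemannian_chart A U \<phi> g e (card (Basis :: 'e set))"
    by unfold_locales (simp_all add: atLeast0LessThan insert_absorb[OF U(1)] atlas)
  then show thesis using that U(2) by blast
qed

text \<open>Koszul identities concern fields, while \<open>metric_eqI\<close> tests against vectors.
  A vector is extended to a field by constant coefficients in a frame.\<close>

lemma vector_eqI:
  assumes U: "open U" "p \<in> U" and uv: "u \<in> tangent_space A p" "v \<in> tangent_space A p"
    and eq: "\<And>V Z. open V \<Longrightarrow> p \<in> V \<Longrightarrow> V \<subseteq> U \<Longrightarrow> Z \<in> vfields A V \<Longrightarrow> g p u (Z p) = g p v (Z p)"
  shows "u = v"
proof (rule metric_eqI[OF uv])
  fix w assume w: "w \<in> tangent_space A p"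
  obtain V \<phi> e N where V: "riemannian_chart A V \<phi> g e N" "p \<in> V"
    by (rule riemannian_chart_around)
  interpret riemannian_chart A V \<phi> g e N by (rule V(1))
  define c where "c k = g p w (frame k p) / g p (frame k p) (frame k p)" for k
  let ?Z = "\<Sum>k<N. fscale (\<lambda>_. c k) (frame k)"
  have "?Z p = w"
    using frame_expansion[OF V(2) w] by (simp add: sum_fun_apply fscale_def c_def)
  moreover have "?Z \<in> vfields A (U \<inter> V)"
    using vfields_subset[OF frame_extension[OF subset_refl]] by blast
  then have "g p u (?Z p) = g p v (?Z p)"
    using U V open_dom by (intro eq[of "U \<inter> V"]) auto
  ultimately show "g p u w = g p v w" by simp
qed

text \<open>Characterised by testing against all local fields rather than by a frame formula, so
  that no choice of a chart enters.\<close>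

definition koszul_connection :: "'p vfield \<Rightarrow> 'p vfield \<Rightarrow> 'p vfield" where
  "koszul_connection X Y p = (THE w. w \<in> tangent_space A p \<and>
     (\<forall>V Z. open V \<longrightarrow> p \<in> V \<longrightarrow> Z \<in> vfields A V \<longrightarrow> 2 * g p w (Z p) = koszul A g X Y Z p))"

text \<open>The frame sum has the defining property by \<open>koszul_representation\<close>, and
  \<open>vector_eqI\<close> makes it the only such vector. The formula holds in every frame around
  \<open>p\<close>, hence throughout the domain of a single frame, which yields smoothness.\<close>

lemma koszul_connection_eq:
  assumes U: "open U" "p \<in> U" and X: "X \<in> vfields A U" and Y: "Y \<in> vfields A U"
    and W: "riemannian_chart A W \<phi> g e N" "p \<in> W"
  shows "koszul_connection X Y p = (\<Sum>k<N. (koszul A g X Y (riemannian_chart.frame A W \<phi> g e k) p /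
      (2 * g p (riemannian_chart.frame A W \<phi> g e k p) (riemannian_chart.frame A W \<phi> g e k p)))
        *\<^sub>T riemannian_chart.frame A W \<phi> g e k p)"
    (is "_ = ?w")
    and "koszul_connection X Y p \<in> tangent_space A p"
    and "\<And>V Z. open V \<Longrightarrow> p \<in> V \<Longrightarrow> Z \<in> vfields A V \<Longrightarrow>
      2 * g p (koszul_connection X Y p) (Z p) = koszul A g X Y Z p"
proof -
  interpret W: riemannian_chart A W \<phi> g e N by (rule W(1))
  have w: "?w \<in> tangent_space A p"
    using W(2) W.frame_tangent by (intro tangent_space_sum tangent_space_scale) auto
  have rep: "2 * g p ?w (Z p) = koszul A g X Y Z p" if V: "open V" "p \<in> V" "Z \<in> vfields A V" for V Z
    by (rule W.koszul_representation[of "U \<inter> V"])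
      (use U V W(2) X Y vfields_subset in auto)
  show eq: "koszul_connection X Y p = ?w"
    unfolding koszul_connection_def
  proof (rule the_equality)
    show "?w \<in> tangent_space A p \<and> (\<forall>V Z. open V \<longrightarrow> p \<in> V \<longrightarrow> Z \<in> vfields A V \<longrightarrow>
        2 * g p ?w (Z p) = koszul A g X Y Z p)"
      using w rep by blast
    fix u assume u: "u \<in> tangent_space A p \<and> (\<forall>V Z. open V \<longrightarrow> p \<in> V \<longrightarrow> Z \<in> vfields A V \<longrightarrow>
        2 * g p u (Z p) = koszul A g X Y Z p)"
    show "u = ?w"
    proof (rule vector_eqI[OF U _ w])
      show "u \<in> tangent_space A p" using u by blast
      fix V Z assume V: "open V" "p \<in> V" "V \<subseteq> U" "Z \<in> vfields A V"
      then have "2 * g p u (Z p) = 2 * g p ?w (Z p)"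
        using u rep[of V Z] by simp
      then show "g p u (Z p) = g p ?w (Z p)" by simp
    qed
  qed
  show "koszul_connection X Y p \<in> tangent_space A p"
    unfolding eq by (rule w)
  show "2 * g p (koszul_connection X Y p) (Z p) = koszul A g X Y Z p"
    if "open V" "p \<in> V" "Z \<in> vfields A V" for V Z
    unfolding eq by (rule rep[OF that])
qed

lemma koszul_connection_tangent:
  assumes "open U" "p \<in> U" "X \<in> vfields A U" "Y \<in> vfields A U"
  shows "koszul_connection X Y p \<in> tangent_space A p"
proof -
  obtain V \<phi> e N where "riemannian_chart A V \<phi> g e N" "p \<in> V"
    by (rule riemannian_chart_around)
  from koszul_connection_eq(2)[OF assms this] show ?thesis .
qed

lemma koszul_connection_koszul:
  assumes "open U" "p \<in> U" "X \<in> vfields A U" "Y \<in> vfields A U" "open V" "p \<in> V" "Z \<in> vfields A V"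
  shows "g p (koszul_connection X Y p) (Z p) = koszul A g X Y Z p / 2"
proof -
  obtain W \<phi> e N where "riemannian_chart A W \<phi> g e N" "p \<in> W"
    by (rule riemannian_chart_around)
  from koszul_connection_eq(3)[OF assms(1-4) this assms(5-7)] show ?thesis by simp
qed

lemma koszul_connection_vfields:
  assumes U: "open U" and X: "X \<in> vfields A U" and Y: "Y \<in> vfields A U"
  shows "koszul_connection X Y \<in> vfields A U"
proof (rule vfields_local)
  fix p assume p: "p \<in> U"
  obtain W \<phi> e N where W: "riemannian_chart A W \<phi> g e N" "p \<in> W"
    by (rule riemannian_chart_around)
  interpret W: riemannian_chart A W \<phi> g e N by (rule W(1))
  let ?V = "U \<inter> W"
  let ?f = "\<lambda>k q. koszul A g X Y (W.frame k) q / (2 * g q (W.frame k q) (W.frame k q))"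
  have V: "open ?V" using U W.open_dom by blast
  have vf: "X \<in> vfields A ?V" "Y \<in> vfields A ?V"
    using X Y vfields_subset by auto
  have E: "W.frame k \<in> vfields A ?V" if "k < N" for k
    using vfields_subset[OF W.frame_vfields[OF that]] by simp
  have f: "smooth_fun A ?V (?f k)" if "k < N" for k
    using W.frame_pos[OF that]
    by (intro smooth_fun_divide smooth_fun_mult smooth_fun_const koszul_smooth metric_smooth V vf E that)
      force
  have "(\<Sum>k<N. fscale (?f k) (W.frame k)) \<in> vfields A ?V"
    using E f by (intro vfields_sum vfields_fscale V) auto
  moreover have "(\<Sum>k<N. fscale (?f k) (W.frame k)) q = koszul_connection X Y q" if "q \<in> ?V" for q
    using koszul_connection_eq(1)[OF U _ X Y W(1), of q] that by (simp add: sum_fun_apply fscale_def)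
  ultimately have "koszul_connection X Y \<in> vfields A ?V"
    by (rule vfields_cong)
  then show "\<exists>V. open V \<and> p \<in> V \<and> koszul_connection X Y \<in> vfields A V"
    using V p W(2) by blast
qed

text \<open>Each law becomes, after testing against a local field, the corresponding identity for
  \<open>koszul\<close>; compatibility is \<open>koszul_skew\<close>, torsion-freeness is
  \<open>koszul_swap\<close>.\<close>

lemma koszul_connection_is_levi_civita: "is_levi_civita A g koszul_connection"
proof -
  let ?D = koszul_connection
  have main: "?D (X + Z) Y p = ?D X Y p + ?D Z Y p \<and> ?D X (Y + Z) p = ?D X Y p + ?D X Z p \<and>
      ?D X Y p - ?D Y X p = lie_bracket A X Y p \<and>
      X p (\<lambda>q. g q (Y q) (Z q)) = g p (?D X Y p) (Z p) + g p (Y p) (?D X Z p)"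
    if U: "open U" "p \<in> U" and X: "X \<in> vfields A U" and Y: "Y \<in> vfields A U" and Z: "Z \<in> vfields A U"
    for U p X Y Z
  proof (intro conjI)
    note T = koszul_connection_tangent[OF U]
    note K = koszul_connection_koszul[OF U]
    note add = vfields_add[OF U(1)]
    show "?D (X + Z) Y p = ?D X Y p + ?D Z Y p"
    proof (rule vector_eqI[OF U])
      fix V T' assume V: "open V" "p \<in> V" "V \<subseteq> U" "T' \<in> vfields A V"
      note [simp] = X[THEN vfields_subset, OF V(3)] Y[THEN vfields_subset, OF V(3)] Z[THEN vfields_subset, OF V(3)]
      show "g p (?D (X + Z) Y p) (T' p) = g p (?D X Y p + ?D Z Y p) (T' p)"
        using V by (simp only: metric_add_left[OF T[OF X Y] T[OF Z Y] vfields_tangent[OF V(4,2)]]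
            K[OF add[OF X Z] Y V(1,2,4)] K[OF X Y V(1,2,4)] K[OF Z Y V(1,2,4)])
          (simp add: koszul_add_left[OF V(1,2)])
    qed (intro T add tangent_space_add X Y Z)+
    show "?D X (Y + Z) p = ?D X Y p + ?D X Z p"
    proof (rule vector_eqI[OF U])
      fix V T' assume V: "open V" "p \<in> V" "V \<subseteq> U" "T' \<in> vfields A V"
      note [simp] = X[THEN vfields_subset, OF V(3)] Y[THEN vfields_subset, OF V(3)] Z[THEN vfields_subset, OF V(3)]
      show "g p (?D X (Y + Z) p) (T' p) = g p (?D X Y p + ?D X Z p) (T' p)"
        using V by (simp only: metric_add_left[OF T[OF X Y] T[OF X Z] vfields_tangent[OF V(4,2)]]
            K[OF X add[OF Y Z] V(1,2,4)] K[OF X Y V(1,2,4)] K[OF X Z V(1,2,4)])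
          (simp add: koszul_add_middle[OF V(1,2)])
    qed (intro T add tangent_space_add X Y Z)+
    show "?D X Y p - ?D Y X p = lie_bracket A X Y p"
    proof (rule vector_eqI[OF U])
      fix V T' assume V: "open V" "p \<in> V" "V \<subseteq> U" "T' \<in> vfields A V"
      note vf = X[THEN vfields_subset, OF V(3)] Y[THEN vfields_subset, OF V(3)]
      show "g p (?D X Y p - ?D Y X p) (T' p) = g p (lie_bracket A X Y p) (T' p)"
        by (simp only: metric_diff_left[OF T[OF X Y] T[OF Y X] vfields_tangent[OF V(4,2)]]
            K[OF X Y V(1,2,4)] K[OF Y X V(1,2,4)] koszul_swap[OF V(1,2) vf(2,1) V(4)]) (simp add: field_simps)
    qed (intro T tangent_space_diff lie_bracket_tangent[OF U] X Y)+
    have "g p (Y p) (?D X Z p) = g p (?D X Z p) (Y p)"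
      by (rule metric_sym[OF vfields_tangent[OF Y U(2)] T[OF X Z]])
    then show "X p (\<lambda>q. g q (Y q) (Z q)) = g p (?D X Y p) (Z p) + g p (Y p) (?D X Z p)"
      using koszul_skew[OF U X Z Y] by (simp add: K[OF X Y U Z] K[OF X Z U Y])
  qed
  have scale: "?D (fscale f X) Y p = f p *\<^sub>T ?D X Y p \<and>
      ?D X (fscale f Y) p = X p f *\<^sub>T Y p + f p *\<^sub>T ?D X Y p"
    if U: "open U" "p \<in> U" and X: "X \<in> vfields A U" and Y: "Y \<in> vfields A U" and f: "smooth_fun A U f"
    for U p X Y f
  proof
    note T = koszul_connection_tangent[OF U]
    note K = koszul_connection_koszul[OF U]
    note fX = vfields_fscale[OF U(1) X f] and fY = vfields_fscale[OF U(1) Y f]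
    show "?D (fscale f X) Y p = f p *\<^sub>T ?D X Y p"
    proof (rule vector_eqI[OF U])
      fix V T' assume V: "open V" "p \<in> V" "V \<subseteq> U" "T' \<in> vfields A V"
      note vf = X[THEN vfields_subset, OF V(3)] Y[THEN vfields_subset, OF V(3)]
      show "g p (?D (fscale f X) Y p) (T' p) = g p (f p *\<^sub>T ?D X Y p) (T' p)"
        by (simp only: metric_scale_left[OF T[OF X Y] vfields_tangent[OF V(4,2)]]
            K[OF fX Y V(1,2,4)] K[OF X Y V(1,2,4)]
            koszul_fscale_left[OF V(1,2) vf V(4) smooth_fun_subset[OF f V(3)]] times_divide_eq_right)
    qed (intro T tangent_space_scale fX X Y)+
    show "?D X (fscale f Y) p = X p f *\<^sub>T Y p + f p *\<^sub>T ?D X Y p"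
    proof (rule vector_eqI[OF U])
      fix V T' assume V: "open V" "p \<in> V" "V \<subseteq> U" "T' \<in> vfields A V"
      note vf = X[THEN vfields_subset, OF V(3)] Y[THEN vfields_subset, OF V(3)]
      show "g p (?D X (fscale f Y) p) (T' p) = g p (X p f *\<^sub>T Y p + f p *\<^sub>T ?D X Y p) (T' p)"
        by (simp only: metric_lincomb_left[OF vfields_tangent[OF Y U(2)] T[OF X Y] vfields_tangent[OF V(4,2)]]
            K[OF X fY V(1,2,4)] K[OF X Y V(1,2,4)]
            koszul_fscale_middle[OF V(1,2) vf V(4) smooth_fun_subset[OF f V(3)]])
          (simp add: field_simps)
    qed (intro T tangent_space_scale tangent_space_add vfields_tangent[OF Y U(2)] fY X Y)+
  qed
  \<comment> \<open>Torsion involves two fields only, so \<open>main\<close> is used with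
    \<open>X\<close> in the place of the third as well.\<close>
  have torsion: "?D X Y p - ?D Y X p = lie_bracket A X Y p"
    if "open U" "X \<in> vfields A U" "Y \<in> vfields A U" "p \<in> U" for U p X Y
    using main[OF that(1,4,2,3,2)] by blast
  show ?thesis
    unfolding is_levi_civita_def affine_connection_def
    by (intro conjI allI impI ballI)
      (rule koszul_connection_vfields torsion main[THEN conjunct1] main[THEN conjunct2, THEN conjunct1]
        main[THEN conjunct2, THEN conjunct2, THEN conjunct2] scale[THEN conjunct1] scale[THEN conjunct2];
        assumption)+
qed

text \<open>Existence gives the choice in \<open>levi_civita\<close> its meaning; everything later
  uses the connection only through its axioms.\<close>

lemma levi_civita_is_levi_civita: "is_levi_civita A g (levi_civita A g)"
  unfolding levi_civita_def using someI[of "is_levi_civita A g", OF koszul_connection_is_levi_civita] .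

end

section \<open>Foliated charts and adapted frames\<close>

lemma smooth_atlas_subset:
  assumes "smooth_atlas B" "C \<subseteq> B" "(\<Union>(U, \<phi>)\<in>C. U) = UNIV"
  shows "smooth_atlas C"
  unfolding smooth_atlas_def assms(3)
proof (intro conjI ballI refl)
  show "is_chart c" if "c \<in> C" for c
    using assms(1,2) that unfolding smooth_atlas_def by blast
  fix c assume "c \<in> C"
  then have "c \<in> B" using assms(2) by blast
  then show "case c of (U, \<phi>) \<Rightarrow> \<forall>(V, \<psi>)\<in>C. smooth_on (\<phi> ` (U \<inter> V)) (\<psi> \<circ> inv_into U \<phi>)"
    using assms(1,2) by (cases c) (fastforce simp: smooth_atlas_def)
qed

text \<open>The vectors (0, v) along the leaves receive the indices below \<open>m\<close>, the
  transverse ones (u, 0) the rest. Gram-Schmidt in this order never mixes transverse vectors into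
  the first \<open>m\<close>.\<close>

lemma basis_enumeration:
  obtains e :: "nat \<Rightarrow> 'a::euclidean_space \<times> 'b::euclidean_space" and m N
  where "m \<le> N" "bij_betw e {..<N} Basis" "\<And>k. k < m \<Longrightarrow> fst (e k) = 0"
    "\<And>k. m \<le> k \<Longrightarrow> k < N \<Longrightarrow> e k \<in> (\<lambda>u. (u, 0)) ` Basis"
proof -
  let ?V = "(\<lambda>v. (0, v)) ` (Basis :: 'b set) :: ('a \<times> 'b) set"
  let ?H = "(\<lambda>u. (u, 0)) ` (Basis :: 'a set) :: ('a \<times> 'b) set"
  obtain h1 where h1: "bij_betw h1 {0..<card ?V} ?V"
    using ex_bij_betw_nat_finite[of ?V] by auto
  obtain h2 where h2: "bij_betw h2 {0..<card ?H} ?H"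
    using ex_bij_betw_nat_finite[of ?H] by auto
  define m N where "m = card ?V" and "N = card ?V + card ?H"
  define e where "e k = (if k < m then h1 k else h2 (k - m))" for k
  have b1: "bij_betw e {..<m} ?V"
    using h1 by (subst bij_betw_cong[of _ _ h1]) (auto simp: atLeast0LessThan e_def m_def)
  have "bij_betw (\<lambda>k. k - m) {m..<N} {0..<card ?H}"
    by (rule bij_betwI[where g = "\<lambda>k. k + m"]) (auto simp: m_def N_def)
  from bij_betw_trans[OF this h2] have b2: "bij_betw e {m..<N} ?H"
    by (subst bij_betw_cong[of _ _ "h2 \<circ> (\<lambda>k. k - m)"]) (auto simp: e_def)
  have "bij_betw e ({..<m} \<union> {m..<N}) (?V \<union> ?H)"
    by (rule bij_betw_combine[OF b1 b2]) auto
  moreover have "{..<m} \<union> {m..<N} = {..<N}" by (auto simp: m_def N_def)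
  moreover have "?V \<union> ?H = Basis" by (auto simp: Basis_prod_def)
  ultimately have "bij_betw e {..<N} Basis" by simp
  moreover have "fst (e k) = 0" if "k < m" for k
  proof -
    have "e k \<in> ?V" using bij_betwE[OF b1] that by blast
    then show ?thesis by auto
  qed
  moreover have "e k \<in> ?H" if "m \<le> k" "k < N" for k
    using bij_betwE[OF b2] that by simp
  ultimately show thesis
    using that[of m N e] by (simp add: m_def N_def)
qed

locale foliated_riemannian_manifold = riemannian_manifold A g
  for A :: "('p::{t2_space,second_countable_topology}, (real^'n::finite) \<times> (real^'m::finite)) chart set"
    and g :: "'p tensor02" +
  fixes F :: "('p, (real^'n::finite) \<times> (real^'m::finite)) chart set"
  assumes foliation: "foliation A F"
begin

lemma foliated_chart:
  assumes "(U, \<phi>) \<in> F"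
  shows "compatible_chart A U \<phi>"
proof
  show "smooth_atlas (insert (U, \<phi>) A)"
  proof (rule smooth_atlas_subset)
    show "smooth_atlas (A \<union> F)" using foliation by (simp add: foliation_def)
    have "(\<Union>(U, \<phi>)\<in>A. U) = UNIV" using atlas by (simp add: smooth_atlas_def)
    then show "(\<Union>(U, \<phi>)\<in>insert (U, \<phi>) A. U) = UNIV" by auto
  qed (use assms in auto)
qed

lemma foliated_chart_around: obtains U \<phi> where "(U, \<phi>) \<in> F" "p \<in> U"
proof -
  have "(\<Union>(U, \<phi>)\<in>F. U) = UNIV"
    using foliation by (simp add: foliation_def smooth_atlas_def)
  then show thesis
    using that by blast
qed

lemma transverse_transition:
  assumes "(U, \<phi>) \<in> F" "(V, \<psi>) \<in> F" "p \<in> U" "p \<in> V"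
  obtains W \<eta> where "open W" "p \<in> W" "W \<subseteq> U \<inter> V" "\<forall>q\<in>W. fst (\<psi> q) = \<eta> (fst (\<phi> q))"
proof -
  have "\<forall>(U, \<phi>)\<in>F. \<forall>(V, \<psi>)\<in>F. \<forall>p\<in>U \<inter> V.
      \<exists>W \<eta>. open W \<and> p \<in> W \<and> W \<subseteq> U \<inter> V \<and> (\<forall>q\<in>W. fst (\<psi> q) = \<eta> (fst (\<phi> q)))"
    using foliation unfolding foliation_def by (elim conjE)
  from bspec[OF bspec[OF this assms(1), unfolded prod.case] assms(2), unfolded prod.case, rule_format, of p]
  show thesis
    using assms(3,4) that by blast
qed

section \<open>Vertical and horizontal vectors\<close>

lemma vertical_tangent: "v \<in> vertical A F p \<Longrightarrow> v \<in> tangent_space A p"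
  by (simp add: vertical_def)

lemma verticalI:
  "v \<in> tangent_space A p \<Longrightarrow> (\<And>U \<phi> i. (U, \<phi>) \<in> F \<Longrightarrow> p \<in> U \<Longrightarrow> v (\<lambda>q. fst (\<phi> q) $ i) = 0)
    \<Longrightarrow> v \<in> vertical A F p"
  by (auto simp: vertical_def)

lemma verticalD: "v \<in> vertical A F p \<Longrightarrow> (U, \<phi>) \<in> F \<Longrightarrow> p \<in> U \<Longrightarrow> v (\<lambda>q. fst (\<phi> q) $ i) = 0"
  by (auto simp: vertical_def)

lemma vertical_scale: "v \<in> vertical A F p \<Longrightarrow> c *\<^sub>T v \<in> vertical A F p"
  by (rule verticalI[OF tangent_space_scale[OF vertical_tangent]]) (auto simp: tscale_def verticalD)

lemma vertical_sum:
  assumes "\<And>i. i \<in> J \<Longrightarrow> v i \<in> vertical A F p"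
  shows "(\<Sum>i\<in>J. v i) \<in> vertical A F p"
proof (rule verticalI[OF tangent_space_sum[OF vertical_tangent[OF assms]]])
  fix U \<phi> i assume "(U, \<phi>) \<in> F" "p \<in> U"
  then show "(\<Sum>i\<in>J. v i) (\<lambda>q. fst (\<phi> q) $ i) = 0"
    unfolding sum_fun_apply using verticalD[OF assms] by (intro sum.neutral) blast
qed

lemma vertical_diff: "u \<in> vertical A F p \<Longrightarrow> v \<in> vertical A F p \<Longrightarrow> u - v \<in> vertical A F p"
  by (rule verticalI) (auto simp: verticalD intro!: tangent_space_diff intro: vertical_tangent)

lemma horizontal_tangent: "u \<in> horizontal A F g p \<Longrightarrow> u \<in> tangent_space A p"
  by (simp add: horizontal_def)

lemma horizontalD: "u \<in> horizontal A F g p \<Longrightarrow> v \<in> vertical A F p \<Longrightarrow> g p u v = 0"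
  by (simp add: horizontal_def)

lemma horizontal_sum:
  assumes "\<And>i. i \<in> J \<Longrightarrow> u i \<in> horizontal A F g p"
  shows "(\<Sum>i\<in>J. c i *\<^sub>T u i) \<in> horizontal A F g p"
  unfolding horizontal_def[of A F g p]
proof (intro CollectI conjI ballI)
  show "(\<Sum>i\<in>J. c i *\<^sub>T u i) \<in> tangent_space A p"
    using horizontal_tangent[OF assms] by (intro tangent_space_sum tangent_space_scale)
  fix v assume v: "v \<in> vertical A F p"
  then have "g p (\<Sum>i\<in>J. c i *\<^sub>T u i) v = (\<Sum>i\<in>J. c i * g p (u i) v)"
    using horizontal_tangent[OF assms] vertical_tangent by (intro metric_sum_left)
  also have "\<dots> = 0"
    using horizontalD[OF assms v] by (intro sum.neutral) simp
  finally show "g p (\<Sum>i\<in>J. c i *\<^sub>T u i) v = 0" .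
qed

text \<open>Involutivity: a vertical field annihilates a transverse coordinate not only at
  \<open>p\<close> but at all nearby points, so differentiating the result once more gives 0, and
  both halves of the bracket vanish.\<close>

lemma lie_bracket_vertical:
  assumes U: "open U" "p \<in> U"
    and Z1: "Z1 \<in> sections A (vertical A F) U" and Z2: "Z2 \<in> sections A (vertical A F) U"
  shows "lie_bracket A Z1 Z2 p \<in> vertical A F p"
proof (rule verticalI)
  have vf: "Z1 \<in> vfields A U" "Z2 \<in> vfields A U"
    using Z1 Z2 by (auto simp: sections_def)
  show "lie_bracket A Z1 Z2 p \<in> tangent_space A p"
    by (rule lie_bracket_tangent[OF U vf])
  fix V \<psi> i assume V: "(V, \<psi>) \<in> F" "p \<in> V"
  let ?x = "\<lambda>q. fst (\<psi> q) $ i"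
  have "open V" using compatible_chart.open_dom[OF foliated_chart[OF V(1)]] .
  have "Z p (\<lambda>q. Z' q ?x) = 0"
    if "Z \<in> sections A (vertical A F) U" "Z' \<in> sections A (vertical A F) U" for Z Z'
  proof (rule tangent_zero_near[of "Z p" p])
    show "Z p \<in> tangent_space A p"
      using that(1) U vertical_tangent by (auto simp: sections_def)
    have "Z' q ?x = 0" if "q \<in> U \<inter> V" for q
      using \<open>Z' \<in> _\<close> that V(1) by (auto simp: sections_def intro: verticalD)
    then show "\<forall>\<^sub>F q in nhds p. Z' q ?x = 0"
      unfolding eventually_nhds using U V \<open>open V\<close> by (intro exI[of _ "U \<inter> V"]) auto
  qed
  from this[OF Z1 Z2] this[OF Z2 Z1] show "lie_bracket A Z1 Z2 p ?x = 0"
    by (simp add: lie_bracket_def)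
qed

text \<open>
  Along the segment \<open>\<phi> p + t b\<close> with \<open>b\<close> in the direction of the leaves, the transverse coordinates
  of every other foliated chart are constant.
\<close>

lemma coord_vf_vertical:
  assumes U: "(U, \<phi>) \<in> F" "p \<in> U" and b: "fst b = 0"
  shows "compatible_chart.coord_vf A U \<phi> b p \<in> vertical A F p"
proof -
  interpret compatible_chart A U \<phi> by (rule foliated_chart[OF U(1)])
  show ?thesis
  proof (rule verticalI[OF coord_vf_tangent[OF U(2)]])
    fix V \<psi> i assume V: "(V, \<psi>) \<in> F" "p \<in> V"
    let ?x = "\<lambda>q. fst (\<psi> q) $ i"
    let ?h = "?x \<circ> inv_into U \<phi>"
    show "coord_vf b p ?x = 0"
    \<comment> \<open>On a function that is not smooth near \<open>p\<close> the default in
      \<open>coord_vf\<close> already gives 0.\<close>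
    proof (cases "smooth_at A p ?x")
      case True
      let ?D = "frechet_derivative ?h (at (\<phi> p))"
      obtain W \<eta> where W: "open W" "p \<in> W" "W \<subseteq> U \<inter> V" "\<forall>q\<in>W. fst (\<psi> q) = \<eta> (fst (\<phi> q))"
        by (rule transverse_transition[OF U(1) V(1) U(2) V(2)])
      have D: "(?h has_derivative ?D) (at (\<phi> p))"
        by (rule smooth_at_has_derivative[OF U(2) True])
      have "((\<lambda>t. \<phi> p + t *\<^sub>R b) has_derivative (\<lambda>t. t *\<^sub>R b)) (at (0::real))"
        by (auto intro!: derivative_eq_intros)
      from has_derivative_compose[OF this, of ?h ?D] D
      have D1: "((\<lambda>t. ?h (\<phi> p + t *\<^sub>R b)) has_derivative (\<lambda>t. ?D (t *\<^sub>R b))) (at (0::real))"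
        by simp
      \<comment> \<open>The transition relation \<open>\<eta>\<close> holds on \<open>W\<close>
        only, so the segment is restricted to parameters that stay in its chart image.\<close>
      let ?T = "(\<lambda>t::real. \<phi> p + t *\<^sub>R b) -` (\<phi> ` W)"
      have T: "open ?T"
        using W open_image by (intro open_vimage continuous_intros) auto
      have "((\<lambda>_. ?x p) has_derivative (\<lambda>t. ?D (t *\<^sub>R b))) (at (0::real))"
      proof (rule has_derivative_transform_within_open[OF D1 T])
        fix t :: real assume "t \<in> ?T"
        then obtain q where q: "q \<in> W" "\<phi> p + t *\<^sub>R b = \<phi> q" by auto
        then have "fst (\<phi> q) = fst (\<phi> p)"
          using b by (metis add.right_neutral fst_add fst_scaleR scaleR_zero_right)
        then have "fst (\<psi> q) = fst (\<psi> p)"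
          using W q by simp
        then show "?h (\<phi> p + t *\<^sub>R b) = ?x p"
          using q W by (simp add: chart_inv subset_iff)
      qed (use W in auto)
      then have "(\<lambda>t::real. ?D (t *\<^sub>R b)) = (\<lambda>t. 0)"
        by (rule has_derivative_unique) simp
      from fun_cong[OF this, of 1] have "?D b = 0"
        by simp
      then show ?thesis
        using True by (simp add: coord_vf_def)
    qed (simp add: coord_vf_def)
  qed
qed

text \<open>The first \<open>m\<close> vectors are built from leaf directions alone, hence vertical.
  The later ones are orthogonal to them, and horizontality follows since the leaf coordinate vectors
  span the vertical space.\<close>

lemma adapted_frame:
  obtains W E and m N :: nat where "open W" "p \<in> W" "m \<le> N"
    "\<And>k. k < N \<Longrightarrow> E k \<in> vfields A W"
    "\<And>k q. k < m \<Longrightarrow> q \<in> W \<Longrightarrow> E k q \<in> vertical A F q"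
    "\<And>k q. m \<le> k \<Longrightarrow> k < N \<Longrightarrow> q \<in> W \<Longrightarrow> E k q \<in> horizontal A F g q"
    "\<And>q v. q \<in> W \<Longrightarrow> v \<in> tangent_space A q \<Longrightarrow> \<exists>c. v = (\<Sum>k<N. c k *\<^sub>T E k q)"
proof -
  obtain U \<phi> where U: "(U, \<phi>) \<in> F" "p \<in> U" by (rule foliated_chart_around)
  obtain e :: "nat \<Rightarrow> (real^'n) \<times> (real^'m)" and m N
    where e: "m \<le> N" "bij_betw e {..<N} Basis" "\<And>k. k < m \<Longrightarrow> fst (e k) = 0"
      "\<And>k. m \<le> k \<Longrightarrow> k < N \<Longrightarrow> e k \<in> (\<lambda>u. (u, 0)) ` Basis"
    by (rule basis_enumeration) (rule that)
  interpret compatible_chart A U \<phi> by (rule foliated_chart[OF U(1)])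
  interpret riemannian_chart A U \<phi> g e N by unfold_locales (rule e(2))
  have vert: "frame k q \<in> vertical A F q" if "k < m" "q \<in> U" for k q
    using that
  proof (induction k rule: less_induct)
    case (less k)
    then show ?case
      by (subst frame_eq)
        (intro vertical_diff vertical_sum vertical_scale coord_vf_vertical[OF U(1)] e(3); auto)
  qed
  have hor: "frame k q \<in> horizontal A F g q" if k: "m \<le> k" "k < N" and q: "q \<in> U" for k q
    unfolding horizontal_def
  proof (intro CollectI conjI ballI)
    show Ek: "frame k q \<in> tangent_space A q" by (rule frame_tangent[OF k(2) q])
    fix v assume v: "v \<in> vertical A F q"
    \<comment> \<open>These coordinates are the transverse ones, so the coordinate expansion of a
      vertical vector stops before \<open>m\<close>.\<close>
    have zero: "v (coord (e j)) = 0" if j: "m \<le> j" "j < N" for j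
    proof -
      obtain i where "e j = (axis i 1, 0)"
        using e(4)[OF j] by (auto simp: Basis_vec_def)
      then have "coord (e j) = (\<lambda>q. fst (\<phi> q) $ i)"
        by (simp add: coord_def inner_prod_def inner_axis)
      then show ?thesis
        using verticalD[OF v U(1) q] by simp
    qed
    \<comment> \<open>A leaf coordinate vector is a combination of frame vectors with index at most
      \<open>j\<close>, all different from \<open>k\<close>.\<close>
    have orth: "g q (coord_vf (e j) q) (frame k q) = 0" if j: "j < m" for j
    proof -
      have jN: "j < N" "j \<noteq> k" "\<And>i. i < j \<Longrightarrow> i < N \<and> i \<noteq> k" using j k e(1) by auto
      have "g q (\<Sum>i<j. coeff (coord_vf (e j)) i q *\<^sub>T frame i q) (frame k q) = 0"
        using jN q k frame_tangent by (subst metric_sum_left) (auto simp: frame_orth)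
      moreover have "(\<Sum>i<j. coeff (coord_vf (e j)) i q *\<^sub>T frame i q) \<in> tangent_space A q"
        using jN q frame_tangent by (intro tangent_space_sum tangent_space_scale) auto
      ultimately show ?thesis
        by (subst coord_vf_frame, subst metric_add_left[OF frame_tangent[OF jN(1) q] _ Ek])
          (use frame_orth[OF jN(1) k(2) jN(2) q] in auto)
    qed
    have "v (coord (e j)) * g q (coord_vf (e j) q) (frame k q) = 0" if "j < N" for j
      using zero orth that by (cases "j < m") auto
    then have "g q (\<Sum>j<N. v (coord (e j)) *\<^sub>T coord_vf (e j) q) (frame k q) = 0"
      using q coord_vf_tangent Ek by (subst metric_sum_left) (auto intro!: sum.neutral)
    then have "g q v (frame k q) = 0"
      using tangent_expansion_enum[OF q vertical_tangent[OF v]] by simp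
    then show "g q (frame k q) v = 0"
      using metric_sym[OF Ek vertical_tangent[OF v]] by simp
  qed
  have ex: "\<exists>c. v = (\<Sum>k<N. c k *\<^sub>T frame k q)" if "q \<in> U" "v \<in> tangent_space A q" for q v
    by (rule exI[of _ "\<lambda>k. g q v (frame k q) / g q (frame k q) (frame k q)"]) (rule frame_expansion[OF that])
  show thesis
    by (rule that[of U m N frame, OF open_dom U(2) e(1) frame_vfields vert hor ex])
qed

text \<open>The horizontal component is delivered as the value of a local horizontal field, because
  it will serve as the third argument of the Koszul formula; constant coefficients in an adapted
  frame provide the extension.\<close>

lemma vertical_horizontal_extension:
  assumes w: "w \<in> tangent_space A p"
  obtains a W X where "a \<in> vertical A F p" "open W" "p \<in> W"
    "X \<in> sections A (horizontal A F g) W" "w = a + X p"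
proof -
  obtain W E and m N :: nat where W: "open W" "p \<in> W" "m \<le> N"
    and E: "\<And>k. k < N \<Longrightarrow> E k \<in> vfields A W"
      "\<And>k q. k < m \<Longrightarrow> q \<in> W \<Longrightarrow> E k q \<in> vertical A F q"
      "\<And>k q. m \<le> k \<Longrightarrow> k < N \<Longrightarrow> q \<in> W \<Longrightarrow> E k q \<in> horizontal A F g q"
      "\<And>q v. q \<in> W \<Longrightarrow> v \<in> tangent_space A q \<Longrightarrow> \<exists>c. v = (\<Sum>k<N. c k *\<^sub>T E k q)"
    by (rule adapted_frame) (rule that)
  obtain c where c: "w = (\<Sum>k<N. c k *\<^sub>T E k p)"
    using E(4)[OF W(2) w] by blast
  let ?X = "\<Sum>k\<in>{m..<N}. fscale (\<lambda>_. c k) (E k)"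
  have X: "?X q = (\<Sum>k\<in>{m..<N}. c k *\<^sub>T E k q)" for q
    by (simp add: sum_fun_apply fscale_def)
  have "?X \<in> vfields A W"
    using E(1) W(1) smooth_fun_const by (intro vfields_sum vfields_fscale) auto
  moreover have "?X q \<in> horizontal A F g q" if "q \<in> W" for q
    unfolding X using E(3) that by (intro horizontal_sum) auto
  ultimately have sec: "?X \<in> sections A (horizontal A F g) W"
    by (simp add: sections_def)
  have vert: "(\<Sum>k<m. c k *\<^sub>T E k p) \<in> vertical A F p"
    using E(2) W(2) by (intro vertical_sum vertical_scale) auto
  have eq: "w = (\<Sum>k<m. c k *\<^sub>T E k p) + ?X p"
    unfolding X c using sum.atLeastLessThan_concat[of 0 m N "\<lambda>k. c k *\<^sub>T E k p"] W(3)
    by (simp add: atLeast0LessThan)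
  show thesis
    by (rule that[OF vert W(1,2) sec eq])
qed

section \<open>Total geodesy through the Koszul formula\<close>

lemma levi_civita_vfields:
  assumes "open U" "X \<in> vfields A U" "Y \<in> vfields A U"
  shows "levi_civita A g X Y \<in> vfields A U"
  using levi_civita_is_levi_civita assms by (simp add: is_levi_civita_def affine_connection_def)

lemma lie_derivative_horizontal:
  assumes tg: "totally_geodesic_leaves A F g" and U: "open U" "p \<in> U"
    and X: "X \<in> sections A (horizontal A F g) U"
    and Z1: "Z1 \<in> sections A (vertical A F) U" and Z2: "Z2 \<in> sections A (vertical A F) U"
  shows "lie_derivative A X g Z1 Z2 p = 0"
proof -
  have vf: "X \<in> vfields A U" "Z1 \<in> vfields A U" "Z2 \<in> vfields A U"
    using X Z1 Z2 by (auto simp: sections_def)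
  have zero: "g q (Z q) (X q) = 0" if "q \<in> U" "Z \<in> sections A (vertical A F) U" for q Z
  proof -
    have "Z q \<in> vertical A F q" "X q \<in> horizontal A F g q"
      using that X by (auto simp: sections_def)
    then show ?thesis
      using metric_sym horizontalD horizontal_tangent vertical_tangent by metis
  qed
  \<comment> \<open>The mixed products vanish on a whole neighbourhood, so their derivatives at
    \<open>p\<close> vanish too.\<close>
  have zero': "v (\<lambda>q. g q (Z q) (X q)) = 0"
    if "v \<in> tangent_space A p" "Z \<in> sections A (vertical A F) U" for v Z
  proof (rule tangent_zero_near[OF that(1)])
    show "\<forall>\<^sub>F q in nhds p. g q (Z q) (X q) = 0"
      unfolding eventually_nhds using U zero that(2) by blast
  qed
  note T = vfields_tangent[OF vf(1) U(2)] vfields_tangent[OF vf(2) U(2)] vfields_tangent[OF vf(3) U(2)]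
  have LC: "levi_civita A g Z1 Z2 p \<in> vertical A F p"
    using tg U Z1 Z2 unfolding totally_geodesic_leaves_def by blast
  have Xp: "X p \<in> horizontal A F g p"
    using X U(2) by (auto simp: sections_def)
  then have "g p (X p) (levi_civita A g Z1 Z2 p) = 0"
    using LC by (rule horizontalD)
  then have "g p (levi_civita A g Z1 Z2 p) (X p) = 0"
    using metric_sym[OF T(1) vertical_tangent[OF LC]] by simp
  then have "koszul A g Z1 Z2 X p = 0"
    using levi_civita_koszul[OF levi_civita_is_levi_civita U vf(2,3,1)] by simp
  \<comment> \<open>Here involutivity of the vertical bundle enters.\<close>
  moreover have "g p (lie_bracket A Z1 Z2 p) (X p) = 0"
  proof -
    have v: "lie_bracket A Z1 Z2 p \<in> vertical A F p"
      by (rule lie_bracket_vertical[OF U Z1 Z2])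
    show ?thesis
      using horizontalD[OF Xp v] metric_sym[OF T(1) vertical_tangent[OF v]] by simp
  qed
  moreover have "g p (lie_bracket A Z X p) w = - g p (lie_bracket A X Z p) w"
    if "Z \<in> vfields A U" "w \<in> tangent_space A p" for Z w
    unfolding lie_bracket_antisym[of Z X]
    by (rule metric_uminus_left[OF lie_bracket_tangent[OF U vf(1) that(1)] that(2)])
  moreover have "g p (Z1 p) (lie_bracket A X Z2 p) = g p (lie_bracket A X Z2 p) (Z1 p)"
    by (rule metric_sym[OF T(2) lie_bracket_tangent[OF U vf(1,3)]])
  ultimately show ?thesis
    unfolding koszul_def lie_derivative_def
    using vf T by (simp add: zero'[OF T(2) Z2] zero'[OF T(3) Z1])
qed

text \<open>Write the new derivative as vertical part plus \<open>X p\<close> with \<open>X\<close>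
  horizontal. All terms of the two Koszul expressions for \<open>X\<close> agree, and the old one is
  0; hence the new derivative is orthogonal to \<open>X p\<close>, its own horizontal part, which
  must vanish.\<close>

lemma totally_geodesic_leaves_transfer:
  assumes g': "riemannian_metric A g'"
    and vv: "\<And>p u v. u \<in> vertical A F p \<Longrightarrow> v \<in> vertical A F p \<Longrightarrow> g' p u v = g p u v"
    and hv: "\<And>p u v. u \<in> horizontal A F g p \<Longrightarrow> v \<in> vertical A F p \<Longrightarrow> g' p u v = 0"
    and tg: "totally_geodesic_leaves A F g"
  shows "totally_geodesic_leaves A F g'"
  unfolding totally_geodesic_leaves_def
proof (intro allI impI ballI)
  interpret M: foliated_riemannian_manifold A g' F
    by unfold_locales (use g' foliation in auto)
  fix U Z1 Z2 p
  assume U: "open U" "p \<in> U"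
    and Z1: "Z1 \<in> sections A (vertical A F) U" and Z2: "Z2 \<in> sections A (vertical A F) U"
  define w where "w = levi_civita A g' Z1 Z2 p"
  have vfU: "Z1 \<in> vfields A U" "Z2 \<in> vfields A U"
    using Z1 Z2 by (auto simp: sections_def)
  have w: "w \<in> tangent_space A p"
    unfolding w_def by (rule vfields_tangent[OF M.levi_civita_vfields[OF U(1) vfU] U(2)])
  obtain a W X where a: "a \<in> vertical A F p" and W: "open W" "p \<in> W"
    and X: "X \<in> sections A (horizontal A F g) W" and w_eq: "w = a + X p"
    by (rule vertical_horizontal_extension[OF w])
  let ?V = "U \<inter> W"
  have V: "open ?V" "p \<in> ?V" using U W by auto
  have vf: "Z1 \<in> vfields A ?V" "Z2 \<in> vfields A ?V" "X \<in> vfields A ?V"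
    using Z1 Z2 X vfields_subset by (auto simp: sections_def)
  have T: "Z1 p \<in> tangent_space A p" "Z2 p \<in> tangent_space A p" "X p \<in> tangent_space A p"
    using vfields_tangent vf V by blast+
  have hX: "X q \<in> horizontal A F g q" if "q \<in> ?V" for q
    using X that by (auto simp: sections_def)
  have vZ: "Z q \<in> vertical A F q" if "q \<in> ?V" "Z \<in> sections A (vertical A F) U" for q Z
    using that by (auto simp: sections_def)
  have cross: "g q v (X q) = 0" "g' q v (X q) = 0" if "q \<in> ?V" "v \<in> vertical A F q" for q v
    using metric_sym[OF vertical_tangent[OF that(2)] horizontal_tangent[OF hX[OF that(1)]]]
      M.metric_sym[OF vertical_tangent[OF that(2)] horizontal_tangent[OF hX[OF that(1)]]]
      horizontalD[OF hX[OF that(1)] that(2)] hv[OF hX[OF that(1)] that(2)] by simp_all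
  \<comment> \<open>Meant for brackets of \<open>X\<close> with vertical fields, which may have both
    components. The horizontal component is orthogonal to \<open>v\<close> for either metric, and on
    the vertical one the metrics agree.\<close>
  have mixed: "g' p u v = g p u v" if u: "u \<in> tangent_space A p" and v: "v \<in> vertical A F p" for u v
  proof -
    obtain b W' Y where b: "b \<in> vertical A F p" and Y: "p \<in> W'" "Y \<in> sections A (horizontal A F g) W'"
      and u_eq: "u = b + Y p"
      by (rule vertical_horizontal_extension[OF u])
    have "Y p \<in> horizontal A F g p" using Y by (auto simp: sections_def)
    then show ?thesis
      unfolding u_eq using b v vertical_tangent horizontal_tangent
      by (simp add: metric_add_left M.metric_add_left vv hv horizontalD)
  qed
  have near: "\<forall>\<^sub>F q in nhds p. Q q" if "\<And>q. q \<in> ?V \<Longrightarrow> Q q" for Q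
    unfolding eventually_nhds using V that by blast
  have mixed': "v (\<lambda>q. g' q (Z q) (X q)) = v (\<lambda>q. g q (Z q) (X q))"
    if "v \<in> tangent_space A p" "Z \<in> sections A (vertical A F) U" for v Z
    using that cross vZ by (intro tangent_cong[OF that(1)] near) simp
  have "X p (\<lambda>q. g' q (Z1 q) (Z2 q)) = X p (\<lambda>q. g q (Z1 q) (Z2 q))"
    using vv vZ Z1 Z2 by (intro tangent_cong[OF T(3)] near) simp
  moreover have "g' p (lie_bracket A Z1 Z2 p) (X p) = g p (lie_bracket A Z1 Z2 p) (X p)"
    using cross[OF V(2) lie_bracket_vertical[OF U Z1 Z2]] by simp
  moreover have "g' p (lie_bracket A Z' X p) (Z p) = g p (lie_bracket A Z' X p) (Z p)"
    if "Z' \<in> vfields A ?V" "Z \<in> sections A (vertical A F) U" for Z Z'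
    using mixed[OF lie_bracket_tangent[OF V that(1) vf(3)] vZ[OF V(2) that(2)]] .
  ultimately have "koszul A g' Z1 Z2 X p = koszul A g Z1 Z2 X p"
    unfolding koszul_def using vf Z1 Z2 by (simp add: mixed'[OF T(1) Z2] mixed'[OF T(2) Z1])
  moreover have "2 * g p (levi_civita A g Z1 Z2 p) (X p) = koszul A g Z1 Z2 X p"
    by (rule levi_civita_koszul[OF levi_civita_is_levi_civita V vf])
  moreover have "2 * g' p w (X p) = koszul A g' Z1 Z2 X p"
    unfolding w_def by (rule M.levi_civita_koszul[OF M.levi_civita_is_levi_civita V vf])
  moreover have "levi_civita A g Z1 Z2 p \<in> vertical A F p"
    using tg U Z1 Z2 unfolding totally_geodesic_leaves_def by blast
  then have "g p (levi_civita A g Z1 Z2 p) (X p) = 0"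
    by (rule cross(1)[OF V(2)])
  ultimately have "g' p w (X p) = 0" by simp
  \<comment> \<open>The vertical summand \<open>a\<close> of \<open>w\<close> drops out, being
    orthogonal to \<open>X p\<close> for the new metric as well.\<close>
  then have "g' p (X p) (X p) = 0"
    unfolding w_eq using M.metric_add_left[OF vertical_tangent[OF a] T(3) T(3)] cross(2)[OF V(2) a] by simp
  then have "X p = 0"
    using M.metric_pos[OF T(3)] by force
  then show "levi_civita A g' Z1 Z2 p \<in> vertical A F p"
    using a w_eq by (simp add: w_def)
qed

end

theorem lemma4p13:
  fixes A F :: "('p::{t2_space,second_countable_topology}, (real^'n::finite) \<times> (real^'m::finite)) chart set"
    and g0 :: "'p tensor02"
    and I :: "real set"
    and g h :: "real \<Rightarrow> 'p tensor02"
  assumes "smooth_atlas A"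
    and "connected (UNIV :: 'p set)"
    and "foliation A F"
    and "riemannian_metric A g0"
    and "complete_metric A g0"
    and "bracket_generating A (horizontal A F g0)"
    and "bundle_like A F g0"
    and "totally_geodesic_leaves A F g0"
    and "transverse_flow A F g0 I g h"
    and "(\<forall>t\<in>I. transverse_tensor A F (h t)) \<or>
         (\<forall>t\<in>I. \<forall>p u v. h t p u v = - 2 * ric_H A F (g t) p u v)"
  shows "\<forall>t\<in>I. totally_geodesic_leaves A F (g t) \<and>
           (\<forall>U (X :: real \<Rightarrow> 'p vfield) Z1 Z2. open U \<longrightarrow> basic A F (g t) U (X t) \<longrightarrow>
              Z1 \<in> sections A (vertical A F) U \<longrightarrow> Z2 \<in> sections A (vertical A F) U \<longrightarrow>
              (\<forall>p\<in>U. lie_derivative A (X t) (g t) Z1 Z2 p = 0))"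
proof
  fix t assume t: "t \<in> I"
  interpret M0: foliated_riemannian_manifold A g0 F
    by unfold_locales (use assms in auto)
  have flow: "is_interval I" "0 \<in> I" "g 0 = g0" "riemannian_metric A (g t)"
    "\<And>p u v. u \<in> horizontal A F g0 p \<Longrightarrow> v \<in> vertical A F p \<Longrightarrow> g t p u v = 0"
    "\<And>s p u v. s \<in> I \<Longrightarrow> u \<in> vertical A F p \<Longrightarrow> v \<in> vertical A F p \<Longrightarrow>
      ((\<lambda>s. g s p u v) has_real_derivative 0) (at s within I)"
    using assms(9) t unfolding transverse_flow_def by simp_all
  interpret M: foliated_riemannian_manifold A "g t" F
    by unfold_locales (use assms flow in auto)
  have "g t p u v = g0 p u v" if "u \<in> vertical A F p" "v \<in> vertical A F p" for p u v
  proof -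
    \<comment> \<open>An interval is convex, so a vanishing derivative within it forces constancy;
      time 0 identifies the constant as the value of \<open>g0\<close>.\<close>
    have "\<exists>c. \<forall>s\<in>I. g s p u v = c"
      using has_field_derivative_zero_constant[OF is_interval_convex[OF flow(1)] flow(6)[OF _ that]] .
    then show ?thesis
      using t flow(2,3) by metis
  qed
  then have tg: "totally_geodesic_leaves A F (g t)"
    by (rule M0.totally_geodesic_leaves_transfer[OF flow(4) _ flow(5) assms(8)])
  have "lie_derivative A (X t) (g t) Z1 Z2 p = 0"
    if "open U" "basic A F (g t) U (X t)" "Z1 \<in> sections A (vertical A F) U"
      "Z2 \<in> sections A (vertical A F) U" "p \<in> U" for U Z1 Z2 p and X :: "real \<Rightarrow> 'p vfield"
    \<comment> \<open>Here \<open>basic\<close> refers to the horizontal bundle of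
      \<open>g t\<close>, so the lemma is taken from the interpretation for \<open>g t\<close>, not
      for \<open>g0\<close>.\<close>
    using that M.lie_derivative_horizontal[OF tg] by (simp add: basic_def)
  with tg show "totally_geodesic_leaves A F (g t) \<and>
      (\<forall>U (X :: real \<Rightarrow> 'p vfield) Z1 Z2. open U \<longrightarrow> basic A F (g t) U (X t) \<longrightarrow>
         Z1 \<in> sections A (vertical A F) U \<longrightarrow> Z2 \<in> sections A (vertical A F) U \<longrightarrow>
         (\<forall>p\<in>U. lie_derivative A (X t) (g t) Z1 Z2 p = 0))"
    by blast
qed

end
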